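(* A biased graph $\Omega$ is $\Gamma$-gainable for all groups $\Gamma$ of size at least three if and only if $\Omega$ is $\mathbb{Z}_3$-gainable and $\mathbb{Z}_2^2$-gainable.
   Context: Graphs are finite and may have loops and parallel edges. A cycle of a graph is a nonempty connected subgraph in which every vertex has degree $2$ (so a loop is a 1-edge cycle and two parallel edges form a 2-edge cycle). A theta subgraph consists of two distinct vertices and three internally disjoint paths joining them. A biased graph is a pair $\Omega=(G,\mathcal{B})$ where $G$ is a graph and $\mathcal{B}$ is a set of cycles of $G$ (called balanced) such that no theta subgraph of $G$ contains exactly two cycles in $\mathcal{B}$. An arc of $G$ is a triple $(e,u,v)$, where $e$ is an edge, $u,v$ are vertices incident with $e$, and $u\neq v$ if $e$ is not a loop. For a group $\Gamma$, a $\Gamma$-gaining of $G$ is a function $\gamma$ from the arcs of $G$ to $\Gamma$ with $\gamma(e,v,u)=\gamma(e,u,v)^{-1}$ for every non-loop edge $e$. The gain of a walk $u_0,e_0,u_1,\ldots,e_{n-1},u_n$ is $\gamma(e_0,u_0,u_1)\cdots\gamma(e_{n-1},u_{n-1},u_n)$. A simple closed walk of a cycle is a closed walk traversing the cycle exactly once; whether its gain is the identity does not depend on starting vertex or direction. Let $\mathcal{B}_\gamma$ be the set of cycles whose simple closed walks have identity gain. $(G,\mathcal{B})$ is $\Gamma$-gainable if there is a $\Gamma$-gaining $\gamma$ of $G$ with $\mathcal{B}=\mathcal{B}_\gamma$. $\mathbb{Z}_n$ is the cyclic group of order $n$ and $\mathbb{Z}_2^2=\mathbb{Z}_2\times\mathbb{Z}_2$.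 *)

theory Defs
  imports "HOL-Algebra.Elementary_Groups"
begin

section \<open>Finite graphs with loops and parallel edges\<close>

text \<open>An edge with a single end is a loop.\<close>

record ('v, 'e) multigraph =
  verts :: "'v set"
  edges :: "'e set"
  ends  :: "'e \<Rightarrow> 'v set"

definition finite_graph :: "('v, 'e) multigraph \<Rightarrow> bool" where
  "finite_graph G \<longleftrightarrow> finite (verts G) \<and> finite (edges G) \<and>
     (\<forall>e\<in>edges G. ends G e \<subseteq> verts G \<and> card (ends G e) \<in> {1, 2})"

definition is_loop :: "('v, 'e) multigraph \<Rightarrow> 'e \<Rightarrow> bool" where
  "is_loop G e \<longleftrightarrow> card (ends G e) = 1"

definition degree :: "('v, 'e) multigraph \<Rightarrow> 'v \<Rightarrow> nat" where
  "degree G v = (\<Sum>e | e \<in> edges G \<and> v \<in> ends G e. if is_loop G e then 2 else 1)"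

definition arcs :: "('v, 'e) multigraph \<Rightarrow> ('e \<times> 'v \<times> 'v) set" where
  "arcs G = {(e, u, v). e \<in> edges G \<and> u \<in> ends G e \<and> v \<in> ends G e \<and> (\<not> is_loop G e \<longrightarrow> u \<noteq> v)}"

text \<open>
  The walk \<open>u\<^sub>0, e\<^sub>0, u\<^sub>1, \<dots>, e\<^sub>n\<^sub>-\<^sub>1, u\<^sub>n\<close> is encoded by its end vertices \<open>u\<^sub>0\<close>, \<open>u\<^sub>n\<close> and the list of
  arcs \<open>(e\<^sub>i, u\<^sub>i, u\<^sub>i\<^sub>+\<^sub>1)\<close>.
\<close>

fun walk :: "('v, 'e) multigraph \<Rightarrow> 'v \<Rightarrow> ('e \<times> 'v \<times> 'v) list \<Rightarrow> 'v \<Rightarrow> bool" where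
  "walk G u [] w \<longleftrightarrow> u \<in> verts G \<and> u = w"
| "walk G u ((e, a, b) # p) w \<longleftrightarrow> a = u \<and> (e, a, b) \<in> arcs G \<and> walk G b p w"

definition walk_verts :: "'v \<Rightarrow> ('e \<times> 'v \<times> 'v) list \<Rightarrow> 'v list" where
  "walk_verts u p = u # map (\<lambda>(e, a, b). b) p"

definition walk_edges :: "('e \<times> 'v \<times> 'v) list \<Rightarrow> 'e list" where
  "walk_edges p = map fst p"

definition connected_graph :: "('v, 'e) multigraph \<Rightarrow> bool" where
  "connected_graph G \<longleftrightarrow> (\<forall>u\<in>verts G. \<forall>v\<in>verts G. \<exists>p. walk G u p v)"


section \<open>Subgraphs, cycles and thetas\<close>

text \<open>A subgraph of a given graph is determined by its vertex set and its edge set.\<close>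

type_synonym ('v, 'e) subgraph = "'v set \<times> 'e set"

definition restrict_graph :: "('v, 'e) multigraph \<Rightarrow> ('v, 'e) subgraph \<Rightarrow> ('v, 'e) multigraph" where
  "restrict_graph G H = G\<lparr>verts := fst H, edges := snd H\<rparr>"

definition is_subgraph :: "('v, 'e) multigraph \<Rightarrow> ('v, 'e) subgraph \<Rightarrow> bool" where
  "is_subgraph G H \<longleftrightarrow> fst H \<subseteq> verts G \<and> snd H \<subseteq> edges G \<and> (\<forall>e\<in>snd H. ends G e \<subseteq> fst H)"

definition contained_in :: "('v, 'e) subgraph \<Rightarrow> ('v, 'e) subgraph \<Rightarrow> bool" where
  "contained_in H K \<longleftrightarrow> fst H \<subseteq> fst K \<and> snd H \<subseteq> snd K"

definition is_cycle :: "('v, 'e) multigraph \<Rightarrow> ('v, 'e) subgraph \<Rightarrow> bool" where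
  "is_cycle G C \<longleftrightarrow> is_subgraph G C \<and> fst C \<noteq> {} \<and> connected_graph (restrict_graph G C) \<and>
     (\<forall>v\<in>fst C. degree (restrict_graph G C) v = 2)"

definition path :: "('v, 'e) multigraph \<Rightarrow> 'v \<Rightarrow> ('e \<times> 'v \<times> 'v) list \<Rightarrow> 'v \<Rightarrow> bool" where
  "path G x p y \<longleftrightarrow> walk G x p y \<and> distinct (walk_verts x p)"

text \<open>
  The paths have to be different, as a path consisting of a single edge has no internal vertices
  and would otherwise be internally disjoint from itself.
\<close>

definition internally_disjoint ::
  "'v \<Rightarrow> 'v \<Rightarrow> ('e \<times> 'v \<times> 'v) list \<Rightarrow> ('e \<times> 'v \<times> 'v) list \<Rightarrow> bool" where
  "internally_disjoint x y p q \<longleftrightarrow> p \<noteq> q \<and>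
     (set (walk_verts x p) - {x, y}) \<inter> (set (walk_verts x q) - {x, y}) = {}"

definition is_theta :: "('v, 'e) multigraph \<Rightarrow> ('v, 'e) subgraph \<Rightarrow> bool" where
  "is_theta G T \<longleftrightarrow> (\<exists>x y p q r. x \<noteq> y \<and> path G x p y \<and> path G x q y \<and> path G x r y \<and>
     internally_disjoint x y p q \<and> internally_disjoint x y p r \<and> internally_disjoint x y q r \<and>
     T = (set (walk_verts x p) \<union> set (walk_verts x q) \<union> set (walk_verts x r),
          set (walk_edges p) \<union> set (walk_edges q) \<union> set (walk_edges r)))"


section \<open>Biased graphs and gainings\<close>

definition biased_graph :: "('v, 'e) multigraph \<Rightarrow> ('v, 'e) subgraph set \<Rightarrow> bool" where
  "biased_graph G \<B> \<longleftrightarrow> finite_graph G \<and> (\<forall>C\<in>\<B>. is_cycle G C) \<and>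
     (\<forall>T. is_theta G T \<longrightarrow> card {C \<in> \<B>. contained_in C T} \<noteq> 2)"

definition gaining ::
  "('g, 'm) monoid_scheme \<Rightarrow> ('v, 'e) multigraph \<Rightarrow> ('e \<times> 'v \<times> 'v \<Rightarrow> 'g) \<Rightarrow> bool" where
  "gaining \<Gamma> G \<gamma> \<longleftrightarrow> \<gamma> \<in> arcs G \<rightarrow> carrier \<Gamma> \<and>
     (\<forall>e u v. (e, u, v) \<in> arcs G \<and> \<not> is_loop G e \<longrightarrow> \<gamma> (e, v, u) = inv\<^bsub>\<Gamma>\<^esub> \<gamma> (e, u, v))"

definition gain ::
  "('g, 'm) monoid_scheme \<Rightarrow> ('e \<times> 'v \<times> 'v \<Rightarrow> 'g) \<Rightarrow> ('e \<times> 'v \<times> 'v) list \<Rightarrow> 'g" where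
  "gain \<Gamma> \<gamma> p = foldr (\<lambda>a g. \<gamma> a \<otimes>\<^bsub>\<Gamma>\<^esub> g) p \<one>\<^bsub>\<Gamma>\<^esub>"

definition simple_closed_walk ::
  "('v, 'e) multigraph \<Rightarrow> ('v, 'e) subgraph \<Rightarrow> ('e \<times> 'v \<times> 'v) list \<Rightarrow> bool" where
  "simple_closed_walk G C p \<longleftrightarrow> (\<exists>u. walk (restrict_graph G C) u p u \<and>
     distinct (tl (walk_verts u p)) \<and> set (tl (walk_verts u p)) = fst C \<and>
     distinct (walk_edges p) \<and> set (walk_edges p) = snd C)"

definition balanced_cycles ::
  "('g, 'm) monoid_scheme \<Rightarrow> ('v, 'e) multigraph \<Rightarrow> ('e \<times> 'v \<times> 'v \<Rightarrow> 'g) \<Rightarrow> ('v, 'e) subgraph set" where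
  "balanced_cycles \<Gamma> G \<gamma> =
     {C. is_cycle G C \<and> (\<forall>p. simple_closed_walk G C p \<longrightarrow> gain \<Gamma> \<gamma> p = \<one>\<^bsub>\<Gamma>\<^esub>)}"

definition gainable ::
  "('g, 'm) monoid_scheme \<Rightarrow> ('v, 'e) multigraph \<Rightarrow> ('v, 'e) subgraph set \<Rightarrow> bool" where
  "gainable \<Gamma> G \<B> \<longleftrightarrow> (\<exists>\<gamma>. gaining \<Gamma> G \<gamma> \<and> \<B> = balanced_cycles \<Gamma> G \<gamma>)"

text \<open>The order of an infinite group is \<open>0\<close> in the library.\<close>

definition at_least_three :: "('g, 'm) monoid_scheme \<Rightarrow> bool" where
  "at_least_three \<Gamma> \<longleftrightarrow> infinite (carrier \<Gamma>) \<or> 3 \<le> order \<Gamma>"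

end

theory Submission
  imports Defs "HOL-Algebra.Weak_Morphisms" "HOL-Library.Multiset"
begin

text \<open>
  Two gainings over \<open>\<int>\<^sub>3\<close> and \<open>\<int>\<^sub>2\<times>\<int>\<^sub>2\<close> with the same balanced cycles combine to a gaining over the product
  whose cycle gains avoid the elements with exactly one trivial component. On the remaining elements
  there is a map \<open>\<phi>\<close> to \<open>{-2, -1, 0, 1, 2}\<close> that vanishes only at the identity and satisfies
  \<open>\<phi> (x y) = \<phi> x + \<phi> y\<close> whenever \<open>x\<close>, \<open>y\<close> and \<open>x y\<close> are all of this kind. Applied to cycle gains, \<open>\<phi>\<close> is
  additive on every theta, and this suffices for an integer gaining with cycle gains \<open>\<phi>\<close> of the given
  ones: edges are added one at a time, and any two paths joining the ends of the new edge are connected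
  by a sequence of theta exchanges. Sending \<open>1\<close> to an element \<open>g\<close> with \<open>g\<^sup>2 \<noteq> 1\<close> keeps the balanced cycles.
  A group of order at least three without such an element contains \<open>\<int>\<^sub>2\<times>\<int>\<^sub>2\<close>.
\<close>

section \<open>Walks\<close>

definition heads :: "('e \<times> 'v \<times> 'v) list \<Rightarrow> 'v list" where
  "heads p = map (\<lambda>(e, a, b). b) p"

definition tails :: "('e \<times> 'v \<times> 'v) list \<Rightarrow> 'v list" where
  "tails p = map (\<lambda>(e, a, b). a) p"

lemma heads_simps [simp]:
  "heads [] = []"
  "heads ((e, a, b) # p) = b # heads p"
  "heads (p @ q) = heads p @ heads q"
  by (simp_all add: heads_def)

lemma tails_simps [simp]:
  "tails [] = []"
  "tails ((e, a, b) # p) = a # tails p"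
  "tails (p @ q) = tails p @ tails q"
  by (simp_all add: tails_def)

lemma heads_eq_Nil_iff [simp]: "heads p = [] \<longleftrightarrow> p = []"
  by (simp add: heads_def)

lemma mem_heads: "y \<in> set (heads p) \<longleftrightarrow> (\<exists>e x. (e, x, y) \<in> set p)"
  by (force simp: heads_def)

lemma mem_tails: "x \<in> set (tails p) \<longleftrightarrow> (\<exists>e y. (e, x, y) \<in> set p)"
  by (force simp: tails_def)

lemma mem_walk_edges: "e \<in> set (walk_edges p) \<longleftrightarrow> (\<exists>x y. (e, x, y) \<in> set p)"
  by (force simp: walk_edges_def)

section \<open>Reversal of arcs and walks\<close>

definition rev_arc :: "'e \<times> 'v \<times> 'v \<Rightarrow> 'e \<times> 'v \<times> 'v" where
  "rev_arc = (\<lambda>(e, a, b). (e, b, a))"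

definition rev_walk :: "('e \<times> 'v \<times> 'v) list \<Rightarrow> ('e \<times> 'v \<times> 'v) list" where
  "rev_walk p = rev (map rev_arc p)"

lemma rev_arc_simp [simp]: "rev_arc (e, a, b) = (e, b, a)"
  by (simp add: rev_arc_def)

lemma rev_walk_simps [simp]:
  "rev_walk [] = []"
  "rev_walk (a # p) = rev_walk p @ [rev_arc a]"
  "rev_walk (p @ q) = rev_walk q @ rev_walk p"
  by (simp_all add: rev_walk_def)

lemma set_rev_walk: "set (rev_walk p) = rev_arc ` set p"
  by (simp add: rev_walk_def)

lemma walk_edges_simps [simp]:
  "walk_edges [] = []"
  "walk_edges (a # p) = fst a # walk_edges p"
  "walk_edges (p @ q) = walk_edges p @ walk_edges q"
  by (simp_all add: walk_edges_def)

lemma walk_edges_rev_walk [simp]: "walk_edges (rev_walk p) = rev (walk_edges p)"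
  by (induction p) auto

lemma heads_rev_walk: "heads (rev_walk p) = rev (tails p)"
  by (induction p) auto

lemma walk_verts_eq [simp]: "walk_verts u p = u # heads p"
  by (simp add: walk_verts_def heads_def)

text \<open>Both sides list the visited vertices in order, so facts about heads carry over to
  tails.\<close>

lemma walk_tails_heads: "walk G u p w \<Longrightarrow> tails p @ [w] = u # heads p"
  by (induction p arbitrary: u) auto

lemma walk_arcs: "walk G u p w \<Longrightarrow> set p \<subseteq> arcs G"
  by (induction p arbitrary: u) fastforce+

lemma walk_edges_subset: "walk G u p w \<Longrightarrow> set (walk_edges p) \<subseteq> edges G"
  using walk_arcs[of G u p w] by (auto simp: mem_walk_edges arcs_def)

text \<open>The counterpart of \<open>simple_closed_walk\<close> with no cycle given in advance.
  Distinct heads alone would admit a single edge run forth and back; distinct edges exclude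
  this.\<close>

definition simple_closed :: "('v, 'e) multigraph \<Rightarrow> ('e \<times> 'v \<times> 'v) list \<Rightarrow> bool" where
  "simple_closed G p \<longleftrightarrow> p \<noteq> [] \<and> (\<exists>u. walk G u p u) \<and> distinct (heads p) \<and> distinct (walk_edges p)"

section \<open>Paths and closed walks in a fixed finite graph\<close>

context
  fixes G :: "('v, 'e) multigraph"
  assumes fin: "finite_graph G"
begin

lemma mem_arcs_iff: "(e, u, v) \<in> arcs G \<longleftrightarrow> e \<in> edges G \<and> ends G e = {u, v}"
proof
  assume *: "(e, u, v) \<in> arcs G"
  hence e: "e \<in> edges G" by (simp add: arcs_def)
  with fin have "card (ends G e) = 1 \<or> card (ends G e) = 2"
    by (auto simp: finite_graph_def)
  with * show "e \<in> edges G \<and> ends G e = {u, v}"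
    by (auto simp: arcs_def is_loop_def card_1_singleton_iff card_2_iff)
qed (auto simp: arcs_def is_loop_def)

lemma is_loop_iff: "(e, u, v) \<in> arcs G \<Longrightarrow> is_loop G e \<longleftrightarrow> u = v"
  by (auto simp: mem_arcs_iff is_loop_def card_insert_if)

lemma arcs_verts: "(e, u, v) \<in> arcs G \<Longrightarrow> u \<in> verts G \<and> v \<in> verts G"
  using fin by (auto simp: mem_arcs_iff finite_graph_def)

lemma rev_arc_arcs: "a \<in> arcs G \<Longrightarrow> rev_arc a \<in> arcs G"
  by (cases a) (auto simp: mem_arcs_iff)

lemma arcs_same_edge:
  "(e, u, v) \<in> arcs G \<Longrightarrow> (e, x, y) \<in> arcs G \<Longrightarrow> (x, y) = (u, v) \<or> (x, y) = (v, u)"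
  by (auto simp: mem_arcs_iff doubleton_eq_iff)

lemma walk_ends_verts: "walk G u p w \<Longrightarrow> u \<in> verts G \<and> w \<in> verts G"
  by (induction p arbitrary: u) (auto dest: arcs_verts)

lemma walk_append: "walk G u (p @ q) w \<longleftrightarrow> (\<exists>v. walk G u p v \<and> walk G v q w)"
  by (induction p arbitrary: u) (auto dest: walk_ends_verts)

lemma walk_rev_walk: "walk G u p w \<Longrightarrow> walk G w (rev_walk p) u"
  by (induction p arbitrary: u)
    (use arcs_verts rev_arc_arcs in \<open>fastforce simp: walk_append\<close>)+

lemma walk_last: "walk G u p w \<Longrightarrow> w = last (walk_verts u p)"
  by (induction p arbitrary: u) auto

lemma closed_walk_heads: "walk G u p u \<Longrightarrow> p \<noteq> [] \<Longrightarrow> u \<in> set (heads p)"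
  using walk_last[of u p u] last_in_set[of "heads p"] by (simp split: if_splits)

text \<open>If the first edge occurred again, the start of the path would be an end of a later arc
  and hence be visited twice.\<close>

lemma path_distinct_edges: "path G u p w \<Longrightarrow> distinct (walk_edges p)"
proof (induction p arbitrary: u)
  case (Cons a p)
  obtain e c d where a: "a = (e, c, d)" by (cases a)
  with Cons.prems have p: "path G d p w" and arc: "(e, c, d) \<in> arcs G" and c: "c \<notin> set (d # heads p)"
    by (auto simp: path_def)
  have "e \<notin> set (walk_edges p)"
  proof
    assume "e \<in> set (walk_edges p)"
    then obtain x y where xy: "(e, x, y) \<in> set p" by (auto simp: mem_walk_edges)
    have w: "walk G d p w" using p by (simp add: path_def)
    have "(e, x, y) \<in> arcs G" using xy walk_arcs[OF w] by blast
    with arc have "c = x \<or> c = y" using arcs_same_edge by blast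
    moreover have "x \<in> set (tails p)" "y \<in> set (heads p)" using xy by (auto simp: mem_heads mem_tails)
    moreover have "set (tails p) \<subseteq> set (d # heads p)"
      using arg_cong[OF walk_tails_heads[OF w], of set] by auto
    ultimately show False using c by auto
  qed
  then show ?case using Cons.IH[OF p] a by simp
qed simp

text \<open>The dictionary between closed walks and paths: without its first arc, a closed walk is a
  path back to the tail of that arc. The edge condition only excludes the return path
  \<open>[(e, v, u)]\<close>.\<close>

lemma simple_closed_Cons:
  "simple_closed G ((e, u, v) # t) \<longleftrightarrow>
     (e, u, v) \<in> arcs G \<and> path G v t u \<and> e \<notin> set (walk_edges t)"
  using path_distinct_edges[of v t u] by (auto simp: simple_closed_def path_def)

lemma simple_closed_rotate: "simple_closed G (p @ q) \<Longrightarrow> simple_closed G (q @ p)"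
  by (fastforce simp: simple_closed_def walk_append)

text \<open>In a closed walk the tails are a rearrangement of the heads.\<close>

lemma simple_closed_distinct_tails: "simple_closed G p \<Longrightarrow> distinct (tails p)"
proof -
  assume p: "simple_closed G p"
  then obtain u where "walk G u p u" by (auto simp: simple_closed_def)
  from arg_cong[OF walk_tails_heads[OF this], of mset]
  have "mset (tails p) = mset (heads p)" by simp
  thus ?thesis using p by (metis mset_eq_imp_distinct_iff simple_closed_def)
qed

lemma simple_closed_rev_walk: "simple_closed G p \<Longrightarrow> simple_closed G (rev_walk p)"
  using simple_closed_distinct_tails[of p] walk_rev_walk
  by (auto simp: simple_closed_def heads_rev_walk) (auto simp: rev_walk_def)

lemma simple_closed_arcs: "simple_closed G p \<Longrightarrow> set p \<subseteq> arcs G"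
  by (auto simp: simple_closed_def dest: walk_arcs)

text \<open>Only the multiset of arcs is recorded, since gains in commutative groups depend on
  nothing more.\<close>

lemma simple_closed_rotate_to:
  assumes "simple_closed G p" and "a \<in> set p"
  obtains t where "simple_closed G (a # t)" and "mset (a # t) = mset p"
proof -
  obtain p1 p2 where p: "p = p1 @ a # p2" using assms(2) by (meson split_list)
  show ?thesis using simple_closed_rotate[of p1 "a # p2"] assms(1)
    by (intro that[of "p2 @ p1"]) (simp_all add: p)
qed

text \<open>With the loop rotated to the front, the rest is a path from \<open>u\<close> to
  \<open>u\<close>, which has to be empty.\<close>

lemma simple_closed_loop:
  assumes "simple_closed G p" and "(e, u, u) \<in> set p"
  shows "p = [(e, u, u)]"
proof -
  obtain t where t: "simple_closed G ((e, u, u) # t)" "mset ((e, u, u) # t) = mset p"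
    using simple_closed_rotate_to[OF assms] .
  hence "path G u t u" by (simp add: simple_closed_Cons)
  hence "t = []"
    using walk_last[of u t u] by (cases t) (auto simp: path_def split: if_splits)
  with t show ?thesis by simp
qed

end

section \<open>Gains of simple closed walks\<close>

text \<open>Meant for nonempty closed walks, where every visited vertex, the start included, is the
  head of an arc.\<close>

definition walk_graph :: "('e \<times> 'v \<times> 'v) list \<Rightarrow> ('v, 'e) subgraph" where
  "walk_graph p = (set (heads p), set (walk_edges p))"

lemma walk_graph_sel [simp]:
  "fst (walk_graph p) = set (heads p)" "snd (walk_graph p) = set (walk_edges p)"
  by (simp_all add: walk_graph_def)

section \<open>Algebra of gains\<close>

lemma gain_Nil [simp]: "gain \<Gamma> \<gamma> [] = \<one>\<^bsub>\<Gamma>\<^esub>"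
  and gain_Cons [simp]: "gain \<Gamma> \<gamma> (a # p) = \<gamma> a \<otimes>\<^bsub>\<Gamma>\<^esub> gain \<Gamma> \<gamma> p"
  by (simp_all add: gain_def)

lemma gain_cong: "(\<And>a. a \<in> set p \<Longrightarrow> \<gamma> a = \<delta> a) \<Longrightarrow> gain \<Gamma> \<gamma> p = gain \<Gamma> \<delta> p"
  by (induction p) auto

lemma (in group) gain_closed: "(\<And>a. a \<in> set p \<Longrightarrow> \<gamma> a \<in> carrier G) \<Longrightarrow> gain G \<gamma> p \<in> carrier G"
  by (induction p) auto

lemma (in group) gain_append:
  "(\<And>a. a \<in> set p \<union> set q \<Longrightarrow> \<gamma> a \<in> carrier G) \<Longrightarrow>
     gain G \<gamma> (p @ q) = gain G \<gamma> p \<otimes> gain G \<gamma> q"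
  by (induction p) (auto simp: gain_closed m_assoc)

lemma (in comm_group) gain_mset_eq:
  "mset p = mset q \<Longrightarrow> (\<And>a. a \<in> set p \<Longrightarrow> \<gamma> a \<in> carrier G) \<Longrightarrow> gain G \<gamma> p = gain G \<gamma> q"
proof (induction p arbitrary: q)
  case (Cons a p)
  have "a \<in> set q" using mset_eq_setD[OF Cons.prems(1)] by auto
  then obtain q1 q2 where q: "q = q1 @ a # q2" by (meson split_list)
  have c: "\<gamma> b \<in> carrier G" if "b \<in> set q" for b
    using Cons.prems that by (metis mset_eq_setD)
  have "gain G \<gamma> p = gain G \<gamma> (q1 @ q2)"
    using Cons.prems by (intro Cons.IH) (auto simp: q)
  also have "\<dots> = gain G \<gamma> q1 \<otimes> gain G \<gamma> q2"
    using c by (intro gain_append) (auto simp: q)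
  finally show ?case
    using gain_append[of q1 "a # q2" \<gamma>] c by (simp add: q gain_closed m_lcomm)
qed simp

lemma (in group) gaining_closed: "gaining G H \<gamma> \<Longrightarrow> a \<in> arcs H \<Longrightarrow> \<gamma> a \<in> carrier G"
  by (auto simp: gaining_def)

lemma gaining_swap:
  "gaining \<Gamma> G \<gamma> \<Longrightarrow> (e, u, v) \<in> arcs G \<Longrightarrow> \<not> is_loop G e \<Longrightarrow>
     \<gamma> (e, v, u) = inv\<^bsub>\<Gamma>\<^esub> \<gamma> (e, u, v)"
  unfolding gaining_def by blast

text \<open>Reversing a loop arc returns the same arc, whose gain need not be its own inverse; hence
  the exclusion of loops.\<close>

lemma (in comm_group) gain_rev_walk:
  assumes "gaining G H \<gamma>" and "set p \<subseteq> arcs H" and "\<forall>(e, u, v) \<in> set p. \<not> is_loop H e"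
  shows "gain G \<gamma> (rev_walk p) = inv (gain G \<gamma> p)"
  using assms(2,3)
proof (induction p)
  case (Cons a p)
  obtain e u v where a: "a = (e, u, v)" by (cases a)
  have r: "\<gamma> (rev_arc a) = inv \<gamma> a" using gaining_swap[OF assms(1)] Cons.prems by (auto simp: a)
  have c: "\<gamma> b \<in> carrier G" if "b \<in> set (a # p)" for b
    using gaining_closed[OF assms(1), of b] Cons.prems(1) that by auto
  have c': "\<gamma> (rev_arc b) \<in> carrier G" if "b \<in> set p" for b
  proof -
    obtain f x y where b: "b = (f, x, y)" by (cases b)
    have "(f, x, y) \<in> arcs H" "\<not> is_loop H f" using Cons.prems that b by auto
    hence "\<gamma> (rev_arc b) = inv (\<gamma> b)"
      using gaining_swap[OF assms(1)] by (simp add: b)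
    thus ?thesis using c that by simp
  qed
  have "gain G \<gamma> (rev_walk (a # p)) = gain G \<gamma> (rev_walk p) \<otimes> inv (\<gamma> a)"
  proof -
    have ca: "\<gamma> (rev_arc a) \<in> carrier G" using r c by simp
    with c' have "\<gamma> b \<in> carrier G" if "b \<in> set (rev_walk p) \<union> set [rev_arc a]" for b
      using that by (auto simp: set_rev_walk)
    hence "gain G \<gamma> (rev_walk p @ [rev_arc a]) = gain G \<gamma> (rev_walk p) \<otimes> gain G \<gamma> [rev_arc a]"
      by (intro gain_append)
    thus ?thesis using ca r by simp
  qed
  also have "\<dots> = inv (gain G \<gamma> p) \<otimes> inv (\<gamma> a)"
    using Cons by auto
  finally show ?case using c by (simp add: gain_closed inv_mult m_comm)
qed simp

section \<open>Simple closed walks as traversals of cycles\<close>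

context
  fixes G :: "('v, 'e) multigraph"
  assumes fin: "finite_graph G"
begin

lemma walk_restrict_graph:
  assumes "is_subgraph G C"
  shows "walk (restrict_graph G C) u p w \<longleftrightarrow>
    u \<in> fst C \<and> walk G u p w \<and> set (walk_edges p) \<subseteq> snd C"
proof -
  have arcs: "a \<in> arcs (restrict_graph G C) \<longleftrightarrow> a \<in> arcs G \<and> fst a \<in> snd C" for a
    using assms by (cases a) (auto simp: arcs_def restrict_graph_def is_subgraph_def is_loop_def)
  have ends: "a \<in> fst C \<and> b \<in> fst C" if "(e, a, b) \<in> arcs G" "e \<in> snd C" for e a b
    using assms that by (auto simp: mem_arcs_iff[OF fin] is_subgraph_def)
  show ?thesis
  proof (induction p arbitrary: u)
    case Nil
    show ?case using assms by (auto simp: restrict_graph_def is_subgraph_def)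
  next
    case (Cons a p)
    obtain e x y where "a = (e, x, y)" by (cases a)
    thus ?case using Cons ends by (auto simp: arcs)
  qed
qed

lemma is_subgraph_walk_graph:
  assumes "simple_closed G p"
  shows "is_subgraph G (walk_graph p)"
proof -
  obtain u where w: "walk G u p u" using assms by (auto simp: simple_closed_def)
  have v: "set (heads p) = set (tails p)"
  proof -
    have "u \<in> set (heads p)" using closed_walk_heads[OF fin w] assms by (simp add: simple_closed_def)
    moreover have "u \<in> set (tails p)" using w assms
      by (cases p) (auto simp: simple_closed_def)
    ultimately show ?thesis using arg_cong[OF walk_tails_heads[OF w], of set] by auto
  qed
  have "ends G e \<subseteq> set (heads p)" if e: "e \<in> set (walk_edges p)" for e
  proof -
    obtain x y where "(e, x, y) \<in> set p" using e by (auto simp: mem_walk_edges)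
    hence "x \<in> set (tails p)" "y \<in> set (heads p)" "(e, x, y) \<in> arcs G"
      using walk_arcs[OF w] by (auto simp: mem_heads mem_tails)
    thus ?thesis using v by (simp add: mem_arcs_iff[OF fin])
  qed
  moreover have "set (heads p) \<subseteq> verts G"
    using walk_arcs[OF w] arcs_verts[OF fin] by (fastforce simp: mem_heads)
  ultimately show ?thesis using walk_edges_subset[OF w]
    by (auto simp: is_subgraph_def walk_graph_def)
qed

text \<open>After rotation the arc entering \<open>x\<close> comes first. The edges at
  \<open>x\<close> are then this one and the first edge of the remaining path; if nothing remains,
  the single edge is a loop and counts twice.\<close>

lemma simple_closed_degree:
  assumes "simple_closed G p" and "x \<in> set (heads p)"
  shows "degree (restrict_graph G (walk_graph p)) x = 2"
proof -
  obtain e u where "(e, u, x) \<in> set p" using assms(2) by (auto simp: mem_heads)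
  then obtain t where t: "simple_closed G ((e, u, x) # t)" "mset ((e, u, x) # t) = mset p"
    using simple_closed_rotate_to[OF fin assms(1)] by metis
  from mset_eq_setD[OF t(2)] have set: "set p = insert (e, u, x) (set t)" by simp
  hence we: "set (walk_edges p) = insert e (set (walk_edges t))"
    by (simp add: walk_edges_def)
  have d: "degree (restrict_graph G (walk_graph p)) x =
      (\<Sum>f | f \<in> set (walk_edges p) \<and> x \<in> ends G f. if is_loop G f then 2 else 1)"
    by (simp add: degree_def restrict_graph_def is_loop_def walk_graph_def)
  have e: "(e, u, x) \<in> arcs G" and path: "path G x t u" and en: "e \<notin> set (walk_edges t)"
    using t(1) by (auto simp: simple_closed_Cons[OF fin])
  show ?thesis
  proof (cases t)
    case Nil
    with path have "u = x" by (simp add: path_def)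
    with e have *: "is_loop G e" "x \<in> ends G e" by (simp_all add: is_loop_iff[OF fin e] mem_arcs_iff[OF fin])
    hence "{f. f \<in> set (walk_edges p) \<and> x \<in> ends G f} = {e}" using we Nil by auto
    thus ?thesis using * by (simp add: d)
  next
    case (Cons b t')
    then obtain f y where b: "b = (f, x, y)" using path by (cases b) (auto simp: path_def)
    have f: "(f, x, y) \<in> arcs G" using path Cons b by (simp add: path_def)
    have t': "walk G y t' u" "x \<noteq> y" "x \<notin> set (heads t')" using path Cons b by (auto simp: path_def)
    have ux: "u \<noteq> x" using walk_last[OF fin t'(1)] t' by (auto split: if_splits)
    have "x \<notin> ends G g" if g_in: "g \<in> set (walk_edges t')" for g
    proof
      assume x: "x \<in> ends G g"
      obtain c d where g: "(g, c, d) \<in> set t'" using g_in by (auto simp: mem_walk_edges)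
      have "ends G g = {c, d}" using g walk_arcs[OF t'(1)] mem_arcs_iff[OF fin] by blast
      hence "x = c \<or> x = d" using x by auto
      moreover have "c \<in> set (tails t')" "d \<in> set (heads t')" using g by (auto simp: mem_heads mem_tails)
      moreover have "set (tails t') \<subseteq> insert y (set (heads t'))"
        using arg_cong[OF walk_tails_heads[OF t'(1)], of set] by auto
      ultimately show False using t' by auto
    qed
    hence "{g. g \<in> set (walk_edges p) \<and> x \<in> ends G g} = {e, f}"
      using we Cons b e f by (auto simp: mem_arcs_iff[OF fin])
    moreover have "e \<noteq> f" using en Cons b by auto
    ultimately show ?thesis
      using is_loop_iff[OF fin e] is_loop_iff[OF fin f] ux t' by (simp add: d)
  qed
qed

lemma is_cycle_walk_graph:
  assumes p: "simple_closed G p"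
  shows "is_cycle G (walk_graph p)"
proof -
  note sub = is_subgraph_walk_graph[OF p]
  obtain u where w: "walk G u p u" using p by (auto simp: simple_closed_def)
  \<comment> \<open>Cutting \<open>p\<close> after the arc that enters \<open>x\<close> gives one
    piece from \<open>u\<close> to \<open>x\<close> and one back to \<open>u\<close>; connectedness
    then goes through \<open>u\<close>.\<close>
  have *: "\<exists>q1 q2. walk (restrict_graph G (walk_graph p)) u q1 x \<and>
      walk (restrict_graph G (walk_graph p)) x q2 u" if x: "x \<in> set (heads p)" for x
  proof -
    obtain e c where "(e, c, x) \<in> set p" using x by (auto simp: mem_heads)
    then obtain p1 p2 where p12: "p = p1 @ (e, c, x) # p2" by (meson split_list)
    hence "walk G u ((p1 @ [(e, c, x)]) @ p2) u" using w by simp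
    then obtain y where y: "walk G u (p1 @ [(e, c, x)]) y" "walk G y p2 u"
      unfolding walk_append[OF fin] by blast
    have "y = x" using walk_last[OF fin y(1)] by simp
    moreover have "u \<in> set (heads p)"
      using closed_walk_heads[OF fin w] p by (simp add: simple_closed_def)
    moreover have "set (walk_edges (p1 @ [(e, c, x)])) \<subseteq> set (walk_edges p)"
      "set (walk_edges p2) \<subseteq> set (walk_edges p)"
      by (auto simp: p12)
    ultimately show ?thesis
      unfolding walk_restrict_graph[OF sub] walk_graph_sel using y x by blast
  qed
  have "connected_graph (restrict_graph G (walk_graph p))"
    unfolding connected_graph_def
  proof (intro ballI)
    fix x y assume xy: "x \<in> verts (restrict_graph G (walk_graph p))" "y \<in> verts (restrict_graph G (walk_graph p))"
    hence "x \<in> set (heads p)" "y \<in> set (heads p)" by (auto simp: restrict_graph_def walk_graph_def)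
    then obtain q1 q2 where q: "walk (restrict_graph G (walk_graph p)) x q1 u"
      "walk (restrict_graph G (walk_graph p)) u q2 y" using * by blast
    show "\<exists>p'. walk (restrict_graph G (walk_graph p)) x p' y"
      using q walk_append[OF fin, of x q1 q2 y] unfolding walk_restrict_graph[OF sub]
      by (metis Un_subset_iff set_append walk_edges_simps(3))
  qed
  thus ?thesis using sub simple_closed_degree[OF p] p
    by (auto simp: is_cycle_def walk_graph_def simple_closed_def)
qed

text \<open>From here on, balance can be treated through \<open>simple_closed\<close> alone, without
  restricted graphs.\<close>

lemma simple_closed_walk_iff:
  assumes "is_cycle G C"
  shows "simple_closed_walk G C p \<longleftrightarrow> simple_closed G p \<and> C = walk_graph p"
proof -
  have sub: "is_subgraph G C" and ne: "fst C \<noteq> {}" using assms by (auto simp: is_cycle_def)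
  have 1: "u \<in> set (heads p)" if "walk G u p u" "p \<noteq> []" for u
    using closed_walk_heads[OF fin that] .
  have 2: "p \<noteq> []" if "set (heads p) = fst C" using that ne by auto
  show ?thesis
  proof
    assume "simple_closed_walk G C p"
    thus "simple_closed G p \<and> C = walk_graph p" using 2
      by (auto simp: simple_closed_walk_def simple_closed_def walk_graph_def walk_restrict_graph[OF sub]
          prod_eq_iff)
  next
    assume *: "simple_closed G p \<and> C = walk_graph p"
    then obtain u where u: "walk G u p u" "p \<noteq> []" by (auto simp: simple_closed_def)
    with * 1 have "walk (restrict_graph G C) u p u"
      using walk_restrict_graph[OF sub] by simp
    thus "simple_closed_walk G C p" using *
      by (auto simp: simple_closed_walk_def simple_closed_def walk_graph_def)
  qed
qed

lemma balanced_cycles_eqI: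
  assumes "\<And>p. simple_closed G p \<Longrightarrow> gain \<Gamma> \<gamma> p = \<one>\<^bsub>\<Gamma>\<^esub> \<longleftrightarrow> gain \<Delta> \<delta> p = \<one>\<^bsub>\<Delta>\<^esub>"
  shows "balanced_cycles \<Gamma> G \<gamma> = balanced_cycles \<Delta> G \<delta>"
  unfolding balanced_cycles_def using assms simple_closed_walk_iff by blast

text \<open>
  Once the two walks share an arc, each next arc is forced, since a vertex is entered only once;
  otherwise every arc is traversed in the opposite direction.
\<close>

lemma simple_closed_same_edges:
  assumes p: "simple_closed G p" and q: "simple_closed G q"
    and eq: "set (walk_edges p) = set (walk_edges q)"
  shows "mset q = mset p \<or> mset q = mset (rev_walk p) \<and> (\<forall>(e, u, v) \<in> set p. \<not> is_loop G e)"
proof -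
  have card: "card (set r) = card (set (walk_edges r)) \<and> distinct r" if "simple_closed G r" for r
    using that by (auto simp: simple_closed_def walk_edges_def distinct_map card_image)
  \<comment> \<open>A simple closed walk has as many arcs as edges, so for equal edge sets an
    inclusion of arc sets is an equality.\<close>
  have sub_eq: "mset r = mset q" if "simple_closed G r" "set (walk_edges r) = set (walk_edges q)" "set r \<subseteq> set q" for r
    using that card[of r] card[of q] q by (simp add: set_eq_iff_mset_eq_distinct[symmetric] card_subset_eq)
  have arc: "(e, x, y) \<in> set q \<or> (e, y, x) \<in> set q" if "(e, x, y) \<in> set p" for e x y
  proof -
    have "e \<in> set (walk_edges q)" using that eq by (auto simp: mem_walk_edges)
    then obtain c d where cd: "(e, c, d) \<in> set q" by (auto simp: mem_walk_edges)
    thus ?thesis using arcs_same_edge[OF fin, of e x y c d] simple_closed_arcs[OF fin p] simple_closed_arcs[OF fin q] that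
      by auto
  qed
  have headq: "e = e' \<and> a = a'" if "(e, a, b) \<in> set q" "(e', a', b) \<in> set q" for e a b e' a'
    using q that by (auto simp: simple_closed_def heads_def distinct_map inj_on_def)
  show ?thesis
  proof (cases "set p \<inter> set q = {}")
    case True
    have "\<not> is_loop G e" if "(e, u, v) \<in> set p" for e u v
      using arc[OF that] True that is_loop_iff[OF fin, of e u v] simple_closed_arcs[OF fin p] by blast
    moreover have "set (rev_walk p) \<subseteq> set q"
      using arc True by (fastforce simp: set_rev_walk)
    hence "mset (rev_walk p) = mset q"
      using simple_closed_rev_walk[OF fin p] eq by (intro sub_eq) auto
    ultimately show ?thesis by auto
  next
    case False
    then obtain a where "a \<in> set p" and a: "a \<in> set q" by auto
    then obtain t where t: "simple_closed G (a # t)" "mset (a # t) = mset p"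
      using simple_closed_rotate_to[OF fin p] by metis
    obtain e u v where a_def: "a = (e, u, v)" by (cases a)
    have sub: "set t \<subseteq> set p" using mset_eq_setD[OF t(2)] by auto
    have "walk G v t u" "distinct (walk_edges (a # t))"
      using t(1) by (auto simp: simple_closed_def a_def)
    moreover have "set t \<subseteq> set q" if "walk G v t w" "distinct (walk_edges ((e, u, v) # t))"
      "(e, u, v) \<in> set q" "set t \<subseteq> set p" for e u v w t
      using that
    proof (induction t arbitrary: e u v)
      case (Cons b t)
      obtain f y where b: "b = (f, v, y)" using Cons.prems(1) by (cases b) auto
      \<comment> \<open>Otherwise \<open>q\<close> would enter \<open>v\<close> by \<open>f\<close>
        as well as by \<open>e\<close>, and distinct heads would force \<open>f = e\<close>.\<close>
      have "(f, y, v) \<notin> set q" using headq[of f y v e u] Cons.prems b by auto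
      hence bq: "(f, v, y) \<in> set q" using arc[of f v y] Cons.prems b by auto
      have "set t \<subseteq> set q" using Cons.prems b bq by (intro Cons.IH[of y f v]) auto
      thus ?case using bq by (simp add: b)
    qed simp
    ultimately have "set t \<subseteq> set q" using a sub unfolding a_def by blast
    moreover have "set (walk_edges (a # t)) = set (walk_edges q)"
      using eq by (simp only: walk_edges_def set_map mset_eq_setD[OF t(2)])
    ultimately have "mset (a # t) = mset q" using t a by (intro sub_eq) auto
    thus ?thesis using t(2) by simp
  qed
qed

end

text \<open>Two traversals of a cycle have the same arcs or reversed ones. The gain is thus
  preserved or inverted, and its triviality is well defined.\<close>

lemma (in comm_group) gain_eq_one_cong:
  assumes "finite_graph H" "gaining G H \<gamma>" "simple_closed H p" "simple_closed H q"
    and "set (walk_edges p) = set (walk_edges q)"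
  shows "gain G \<gamma> p = \<one> \<longleftrightarrow> gain G \<gamma> q = \<one>"
proof -
  have c: "\<gamma> b \<in> carrier G" if "b \<in> set p \<union> set q" for b
    using that gaining_closed[OF assms(2), of b]
      simple_closed_arcs[OF assms(1,3)] simple_closed_arcs[OF assms(1,4)] by auto
  from simple_closed_same_edges[OF assms(1,3,4,5)]
  show ?thesis
  proof (elim disjE conjE)
    assume "mset q = mset p"
    thus ?thesis using gain_mset_eq[of q p] c by simp
  next
    assume *: "mset q = mset (rev_walk p)" "\<forall>(e, u, v)\<in>set p. \<not> is_loop H e"
    have "gain G \<gamma> q = gain G \<gamma> (rev_walk p)" using * c by (intro gain_mset_eq) auto
    also have "\<dots> = inv (gain G \<gamma> p)"
      using assms * by (intro gain_rev_walk) (auto dest: simple_closed_arcs)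
    finally show ?thesis using c by (simp add: gain_closed)
  qed
qed

text \<open>The universal quantifier in \<open>balanced_cycles\<close> may be tested on a single
  traversal.\<close>

lemma (in comm_group) walk_graph_balanced_iff:
  assumes "finite_graph H" "gaining G H \<gamma>" "simple_closed H p"
  shows "walk_graph p \<in> balanced_cycles G H \<gamma> \<longleftrightarrow> gain G \<gamma> p = \<one>"
proof -
  note cyc = is_cycle_walk_graph[OF assms(1,3)]
  have "gain G \<gamma> p = \<one> \<longleftrightarrow> gain G \<gamma> q = \<one>" if "simple_closed H q" "walk_graph p = walk_graph q" for q
    using gain_eq_one_cong[OF assms that(1)] that(2) by (simp add: walk_graph_def)
  thus ?thesis using cyc assms(3) simple_closed_walk_iff[OF assms(1) cyc]
    unfolding balanced_cycles_def by blast
qed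

section \<open>Lifting gains along a partial homomorphism\<close>

lemma gain_hom:
  assumes "group A" "group B" "h \<in> hom A B" "\<And>a. a \<in> set p \<Longrightarrow> \<gamma> a \<in> carrier A"
  shows "gain B (h \<circ> \<gamma>) p = h (gain A \<gamma> p)"
  using assms(4)
proof (induction p)
  case Nil
  show ?case using hom_one[OF assms(3,1,2)] by simp
next
  case (Cons a p)
  thus ?case using assms group.gain_closed[OF assms(1), of p \<gamma>] by (simp add: hom_mult)
qed

lemma gaining_hom:
  assumes "group A" "group B" "h \<in> hom A B" "gaining A G \<gamma>"
  shows "gaining B G (h \<circ> \<gamma>)"
proof -
  interpret group_hom A B h using assms by (simp add: group_hom_def group_hom_axioms_def)
  show ?thesis unfolding gaining_def
  proof (intro conjI allI impI funcsetI)
    fix a assume "a \<in> arcs G"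
    thus "(h \<circ> \<gamma>) a \<in> carrier B" using group.gaining_closed[OF assms(1,4)] by simp
  next
    fix e u v assume e: "(e, u, v) \<in> arcs G \<and> \<not> is_loop G e"
    hence "\<gamma> (e, v, u) = inv\<^bsub>A\<^esub> \<gamma> (e, u, v)" "\<gamma> (e, u, v) \<in> carrier A"
      using gaining_swap[OF assms(4)] group.gaining_closed[OF assms(1,4)] by blast+
    thus "(h \<circ> \<gamma>) (e, v, u) = inv\<^bsub>B\<^esub> (h \<circ> \<gamma>) (e, u, v)" by simp
  qed
qed

text \<open>Instead of injectivity, \<open>h\<close> only has to have no nontrivial cycle gain in
  its kernel. This permits powers of an element of small order.\<close>

lemma gainable_hom:
  assumes "finite_graph G" "group A" "group B" "h \<in> hom A B" "gaining A G \<gamma>"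
    and "\<And>p. simple_closed G p \<Longrightarrow> h (gain A \<gamma> p) = \<one>\<^bsub>B\<^esub> \<Longrightarrow> gain A \<gamma> p = \<one>\<^bsub>A\<^esub>"
  shows "gainable B G (balanced_cycles A G \<gamma>)"
proof -
  have "gain A \<gamma> p = \<one>\<^bsub>A\<^esub> \<longleftrightarrow> gain B (h \<circ> \<gamma>) p = \<one>\<^bsub>B\<^esub>" if p: "simple_closed G p" for p
  proof -
    have "\<gamma> a \<in> carrier A" if "a \<in> set p" for a
      using that simple_closed_arcs[OF assms(1) p] group.gaining_closed[OF assms(2,5)] by blast
    hence "gain B (h \<circ> \<gamma>) p = h (gain A \<gamma> p)"
      by (rule gain_hom[OF assms(2-4)])
    thus ?thesis using assms(6)[OF p] hom_one[OF assms(4,2,3)] by metis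
  qed
  hence "balanced_cycles A G \<gamma> = balanced_cycles B G (h \<circ> \<gamma>)"
    by (intro balanced_cycles_eqI assms(1))
  with gaining_hom[OF assms(2-5)] show ?thesis
    unfolding gainable_def by (intro exI conjI)
qed

text \<open>The letters stand for the gains of an edge \<open>e\<close>, a common initial part
  \<open>s\<close>, exchanged middle parts \<open>x\<close> and \<open>z\<close>, and a common final
  part \<open>w\<close>. The factor \<open>z \<otimes> inv x\<close> is the gain of the cycle formed
  by the middle parts.\<close>

lemma (in comm_group) swap_mult:
  assumes "e \<in> carrier G" "s \<in> carrier G" "x \<in> carrier G" "z \<in> carrier G" "w \<in> carrier G"
  shows "e \<otimes> (s \<otimes> (z \<otimes> w)) = (z \<otimes> inv x) \<otimes> (e \<otimes> (s \<otimes> (x \<otimes> w)))"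
proof -
  \<comment> \<open>With an arbitrary \<open>y\<close> in place of \<open>inv x\<close> this is a
    pure identity of associativity and commutativity.\<close>
  have "(z \<otimes> y) \<otimes> (e \<otimes> (s \<otimes> (x \<otimes> w))) = (x \<otimes> y) \<otimes> (e \<otimes> (s \<otimes> (z \<otimes> w)))"
    if "y \<in> carrier G" for y
    using assms that by (simp add: m_ac)
  from this[of "inv x"] show ?thesis using assms by simp
qed

text \<open>The counterpart in the target group: the exchange multiplies the value on the cycle and
  the gain of the path by the same factor, which cancels.\<close>

lemma (in comm_group) swap_factor:
  assumes "f \<in> carrier G" "s \<in> carrier G" "x \<in> carrier G" "z \<in> carrier G" "w \<in> carrier G"
  shows "(z \<otimes> inv x \<otimes> f) \<otimes> inv (s \<otimes> (z \<otimes> w)) = f \<otimes> inv (s \<otimes> (x \<otimes> w))"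
proof -
  have "(z \<otimes> a \<otimes> f) \<otimes> (b \<otimes> (y \<otimes> c)) = (z \<otimes> y) \<otimes> (f \<otimes> (b \<otimes> (a \<otimes> c)))"
    if "a \<in> carrier G" "b \<in> carrier G" "c \<in> carrier G" "y \<in> carrier G" for a b c y
    using assms that by (simp add: m_ac)
  from this[of "inv x" "inv s" "inv w" "inv z"] show ?thesis using assms by (simp add: inv_mult)
qed

section \<open>Cycles formed by two paths with common ends\<close>

context
  fixes G :: "('v, 'e) multigraph"
  assumes fin: "finite_graph G"
begin

text \<open>A path does not return to its start, so the head \<open>d\<close> is \<open>b\<close>
  and the path stops there. As \<open>c\<close> differs from \<open>d\<close>, it is
  \<open>a\<close>, and nothing precedes the arc.\<close>

lemma path_eq_single_arc:
  assumes "path G a p b" and "(e, c, d) \<in> set p" and "c \<in> {a, b}" and "d \<in> {a, b}"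
  shows "p = [(e, a, b)]"
proof -
  obtain p1 p2 where p: "p = p1 @ (e, c, d) # p2" using assms(2) by (meson split_list)
  with assms(1) have w: "walk G a p1 c" "walk G d p2 b"
    and dist: "distinct (a # heads p1 @ d # heads p2)"
    by (auto simp: path_def walk_append[OF fin])
  have c: "c \<in> insert a (set (heads p1))" "p1 \<noteq> [] \<Longrightarrow> c \<in> set (heads p1)"
    using walk_last[OF fin w(1)] last_in_set[of "heads p1"] by auto
  have b: "p2 \<noteq> [] \<Longrightarrow> b \<in> set (heads p2)"
    using walk_last[OF fin w(2)] last_in_set[of "heads p2"] by auto
  have "d \<noteq> a" using dist by auto
  hence "d = b" using assms(4) by blast
  have p2: "p2 = []"
  proof (rule ccontr)
    assume "p2 \<noteq> []"
    from b[OF this] \<open>d = b\<close> dist show False by simp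
  qed
  have "c \<noteq> d" using c(1) dist by auto
  hence "c = a" using assms(3) \<open>d = b\<close> by blast
  have "p1 = []"
  proof (rule ccontr)
    assume "p1 \<noteq> []"
    from c(2)[OF this] \<open>c = a\<close> dist show False by simp
  qed
  with p p2 \<open>d = b\<close> \<open>c = a\<close> show ?thesis by simp
qed

text \<open>A common edge would have both ends in \<open>{a, b}\<close>, so each path would consist
  of that edge alone, contradicting \<open>x \<noteq> z\<close>.\<close>

lemma simple_closed_two_paths:
  assumes x: "path G a x b" and z: "path G a z b" and "a \<noteq> b" and "x \<noteq> z"
    and disj: "set (heads x) \<inter> set (heads z) \<subseteq> {b}"
  shows "simple_closed G (z @ rev_walk x)"
proof -
  have wx: "walk G a x b" and wz: "walk G a z b"
    and dx: "distinct (a # heads x)" and dz: "distinct (a # heads z)"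
    using x z by (auto simp: path_def)
  have th: "tails x @ [b] = a # heads x" using walk_tails_heads[OF wx] .
  hence dt: "distinct (tails x @ [b])" using dx by (simp only:)
  have tx: "set (tails x) \<union> {b} = insert a (set (heads x))"
    using arg_cong[OF th, of set] by auto
  have tz: "set (tails z) \<union> {b} = insert a (set (heads z))"
    using arg_cong[OF walk_tails_heads[OF wz], of set] by auto
  have edges: "False" if "e \<in> set (walk_edges z)" "e \<in> set (walk_edges x)" for e
  proof -
    obtain c d c' d' where cd: "(e, c, d) \<in> set z" "(e, c', d') \<in> set x"
      using \<open>e \<in> set (walk_edges z)\<close> \<open>e \<in> set (walk_edges x)\<close> by (auto simp: mem_walk_edges)
    have "(c', d') = (c, d) \<or> (c', d') = (d, c)"
      using cd walk_arcs[OF wx] walk_arcs[OF wz] by (intro arcs_same_edge[OF fin, of e]) auto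
    hence eq: "{c', d'} = {c, d}" by auto
    have "c \<in> set (tails z)" "d \<in> set (heads z)" "c' \<in> set (tails x)" "d' \<in> set (heads x)"
      using cd by (auto simp: mem_heads mem_tails)
    hence "{c, d} \<subseteq> insert a (set (heads z))" "{c', d'} \<subseteq> insert a (set (heads x))"
      using tx tz by blast+
    moreover have "insert a (set (heads z)) \<inter> insert a (set (heads x)) \<subseteq> {a, b}"
      using disj by blast
    ultimately have "{c, d} \<subseteq> {a, b}" using eq by blast
    with eq have "c \<in> {a, b}" "d \<in> {a, b}" "c' \<in> {a, b}" "d' \<in> {a, b}" by blast+
    hence "z = [(e, a, b)]" "x = [(e, a, b)]"
      using path_eq_single_arc[OF z cd(1)] path_eq_single_arc[OF x cd(2)] by simp_all
    with \<open>x \<noteq> z\<close> show False by simp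
  qed
  have heads: "set (heads z) \<inter> set (tails x) = {}"
  proof (intro equals0I)
    fix y assume y: "y \<in> set (heads z) \<inter> set (tails x)"
    hence "y \<in> insert a (set (heads x))" "y \<noteq> a" using tx dz by auto
    hence "y = b" using disj y by auto
    with y dt show False by simp
  qed
  have "heads z \<noteq> []" using wz \<open>a \<noteq> b\<close> by auto
  moreover have "walk G a (z @ rev_walk x) a"
    using wz walk_rev_walk[OF fin wx] walk_append[OF fin] by blast
  moreover have "distinct (heads (z @ rev_walk x))"
    using heads dz dt by (simp add: heads_rev_walk)
  moreover have "distinct (walk_edges (z @ rev_walk x))"
  proof -
    have "set (walk_edges z) \<inter> set (walk_edges x) = {}" using edges by blast
    thus ?thesis using path_distinct_edges[OF fin x] path_distinct_edges[OF fin z] by simp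
  qed
  ultimately show ?thesis unfolding simple_closed_def by auto
qed

section \<open>Lifting a gaining edge by edge along a map \<open>\<phi>\<close> that is
  multiplicative only within \<open>D\<close>\<close>

context
  fixes A :: "('a, 'm) monoid_scheme" and K :: "('k, 'n) monoid_scheme"
    and \<gamma> :: "'e \<times> 'v \<times> 'v \<Rightarrow> 'a" and D :: "'a set" and \<phi> :: "'a \<Rightarrow> 'k"
  assumes A: "comm_group A" and K: "comm_group K" and \<gamma>: "gaining A G \<gamma>"
    and D: "\<And>p. simple_closed G p \<Longrightarrow> gain A \<gamma> p \<in> D"
    and \<phi>_closed: "\<And>x. x \<in> D \<Longrightarrow> \<phi> x \<in> carrier K"
    and \<phi>_mult: "\<And>x y. x \<in> D \<Longrightarrow> y \<in> D \<Longrightarrow> x \<otimes>\<^bsub>A\<^esub> y \<in> D \<Longrightarrow> \<phi> (x \<otimes>\<^bsub>A\<^esub> y) = \<phi> x \<otimes>\<^bsub>K\<^esub> \<phi> y"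
    and \<phi>_one: "\<phi> \<one>\<^bsub>A\<^esub> = \<one>\<^bsub>K\<^esub>" "\<one>\<^bsub>A\<^esub> \<in> D"
begin

interpretation A: comm_group A by (rule A)
interpretation K: comm_group K by (rule K)

text \<open>Each side is the gain that \<open>(e, u, v)\<close> needs in order to be right on the
  cycle closed by the respective path. The two cycles through \<open>e\<close> and the cycle
  \<open>z @ rev_walk x\<close> have gains in \<open>D\<close>, so \<open>\<phi>_mult\<close>
  relates them; the third avoids \<open>e\<close>, and there \<open>\<delta>\<close> is already
  correct.\<close>

lemma swap_step:
  assumes \<delta>: "gaining K G \<delta>"
    and F: "\<And>p. simple_closed G p \<Longrightarrow> set (walk_edges p) \<subseteq> F \<Longrightarrow> gain K \<delta> p = \<phi> (gain A \<gamma> p)"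
    and e: "(e, u, v) \<in> arcs G" "e \<notin> F"
    and p1: "path G v (s @ z @ w) u" "set (walk_edges (s @ z @ w)) \<subseteq> F"
    and p2: "path G v (s @ x @ w) u" "set (walk_edges (s @ x @ w)) \<subseteq> F"
    and zx: "path G a z b" "path G a x b" "a \<noteq> b" "set (heads x) \<inter> set (heads z) \<subseteq> {b}"
  shows "\<phi> (gain A \<gamma> ((e, u, v) # s @ z @ w)) \<otimes>\<^bsub>K\<^esub> inv\<^bsub>K\<^esub> gain K \<delta> (s @ z @ w)
       = \<phi> (gain A \<gamma> ((e, u, v) # s @ x @ w)) \<otimes>\<^bsub>K\<^esub> inv\<^bsub>K\<^esub> gain K \<delta> (s @ x @ w)"
proof (cases "x = z")
  case False
  have c: "simple_closed G (z @ rev_walk x)" using simple_closed_two_paths zx False by blast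
  have c1: "simple_closed G ((e, u, v) # s @ z @ w)" and c2: "simple_closed G ((e, u, v) # s @ x @ w)"
    using e p1 p2 by (auto simp: simple_closed_Cons[OF fin])
  have arcs: "set s \<subseteq> arcs G" "set z \<subseteq> arcs G" "set w \<subseteq> arcs G" "set x \<subseteq> arcs G"
    using simple_closed_arcs[OF fin c1] simple_closed_arcs[OF fin c2] by auto
  \<comment> \<open>A loop would be the whole closed walk, but \<open>x\<close> shares its closed
    walk with the arc of \<open>e\<close>.\<close>
  have loops: "\<forall>(f, c, d) \<in> set x. \<not> is_loop G f"
  proof (intro ballI, clarify)
    fix f c d assume f: "(f, c, d) \<in> set x" "is_loop G f"
    hence "c = d" using is_loop_iff[OF fin] arcs by blast
    hence "(e, u, v) # s @ x @ w = [(f, c, c)]" using simple_closed_loop[OF fin c2, of f c] f by auto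
    with f show False by auto
  qed
  have gA: "gain A \<gamma> p \<in> carrier A" if "set p \<subseteq> arcs G" for p
    using that A.gaining_closed[OF \<gamma>] by (intro A.gain_closed) auto
  have gK: "gain K \<delta> p \<in> carrier K" if "set p \<subseteq> arcs G" for p
    using that K.gaining_closed[OF \<delta>] by (intro K.gain_closed) auto
  have apA: "gain A \<gamma> (p @ q) = gain A \<gamma> p \<otimes>\<^bsub>A\<^esub> gain A \<gamma> q" if "set p \<subseteq> arcs G" "set q \<subseteq> arcs G" for p q
    using that A.gaining_closed[OF \<gamma>] by (intro A.gain_append) auto
  have apK: "gain K \<delta> (p @ q) = gain K \<delta> p \<otimes>\<^bsub>K\<^esub> gain K \<delta> q" if "set p \<subseteq> arcs G" "set q \<subseteq> arcs G" for p q
    using that K.gaining_closed[OF \<delta>] by (intro K.gain_append) auto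
  have rx: "set (rev_walk x) \<subseteq> arcs G" using simple_closed_arcs[OF fin c] by auto
  have cz: "gain A \<gamma> (z @ rev_walk x) = gain A \<gamma> z \<otimes>\<^bsub>A\<^esub> inv\<^bsub>A\<^esub> gain A \<gamma> x"
    by (simp only: apA[OF arcs(2) rx] A.gain_rev_walk[OF \<gamma> arcs(4) loops])
  have czK: "gain K \<delta> (z @ rev_walk x) = gain K \<delta> z \<otimes>\<^bsub>K\<^esub> inv\<^bsub>K\<^esub> gain K \<delta> x"
    by (simp only: apK[OF arcs(2) rx] K.gain_rev_walk[OF \<delta> arcs(4) loops])
  have "gain A \<gamma> ((e, u, v) # s @ z @ w)
      = gain A \<gamma> (z @ rev_walk x) \<otimes>\<^bsub>A\<^esub> gain A \<gamma> ((e, u, v) # s @ x @ w)"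
  proof -
    have "gain A \<gamma> ((e, u, v) # s @ z @ w) =
       \<gamma> (e, u, v) \<otimes>\<^bsub>A\<^esub> (gain A \<gamma> s \<otimes>\<^bsub>A\<^esub> (gain A \<gamma> z \<otimes>\<^bsub>A\<^esub> gain A \<gamma> w))"
      using arcs by (simp add: apA)
    also have "\<dots> = gain A \<gamma> (z @ rev_walk x) \<otimes>\<^bsub>A\<^esub> gain A \<gamma> ((e, u, v) # s @ x @ w)"
      unfolding cz using arcs gA A.gaining_closed[OF \<gamma> e(1)] by (simp add: apA flip: A.swap_mult)
    finally show ?thesis .
  qed
  hence "\<phi> (gain A \<gamma> ((e, u, v) # s @ z @ w))
      = \<phi> (gain A \<gamma> (z @ rev_walk x)) \<otimes>\<^bsub>K\<^esub> \<phi> (gain A \<gamma> ((e, u, v) # s @ x @ w))"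
    using \<phi>_mult D[OF c] D[OF c1] D[OF c2] by metis
  also have "\<phi> (gain A \<gamma> (z @ rev_walk x)) = gain K \<delta> z \<otimes>\<^bsub>K\<^esub> inv\<^bsub>K\<^esub> gain K \<delta> x"
    using F[OF c] p1(2) p2(2) czK by simp
  finally show ?thesis
    using arcs gK \<phi>_closed[OF D[OF c2]] by (simp add: apK K.swap_factor)
qed simp

text \<open>
  Writing \<open>t\<^sub>2 = x @ y\<close> where \<open>x\<close> ends at the first vertex of \<open>t\<^sub>2\<close> that lies on \<open>t\<^sub>1 = z @ w\<close>, the path
  \<open>s @ x @ w\<close> differs from \<open>s @ z @ w\<close> by a theta, and it has a longer prefix in common with \<open>s @ t\<^sub>2\<close>.
\<close>

lemma potential_path_independent:
  assumes \<delta>: "gaining K G \<delta>"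
    and F: "\<And>p. simple_closed G p \<Longrightarrow> set (walk_edges p) \<subseteq> F \<Longrightarrow> gain K \<delta> p = \<phi> (gain A \<gamma> p)"
    and e: "(e, u, v) \<in> arcs G" "e \<notin> F"
    and "path G v (s @ t1) u" "set (walk_edges (s @ t1)) \<subseteq> F"
    and "path G v (s @ t2) u" "set (walk_edges (s @ t2)) \<subseteq> F"
  shows "\<phi> (gain A \<gamma> ((e, u, v) # s @ t1)) \<otimes>\<^bsub>K\<^esub> inv\<^bsub>K\<^esub> gain K \<delta> (s @ t1)
       = \<phi> (gain A \<gamma> ((e, u, v) # s @ t2)) \<otimes>\<^bsub>K\<^esub> inv\<^bsub>K\<^esub> gain K \<delta> (s @ t2)"
  using assms(5-)
proof (induction t2 arbitrary: s t1 rule: length_induct)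
  case (1 t2 s t1)
  obtain a where a: "walk G v s a" "walk G a t1 u"
    using "1.prems"(1) by (auto simp: path_def walk_append[OF fin])
  have a2: "walk G a t2 u"
  proof -
    obtain a' where "walk G v s a'" "walk G a' t2 u"
      using "1.prems"(3) by (auto simp: path_def walk_append[OF fin])
    thus ?thesis using walk_last[OF fin a(1)] walk_last[OF fin, of v s a'] by simp
  qed
  have a_mem: "a \<in> insert v (set (heads s))"
    using walk_last[OF fin a(1)] last_in_set[of "v # heads s"] by simp
  have d1: "distinct (v # heads s @ heads t1)" and d2: "distinct (v # heads s @ heads t2)"
    using "1.prems" by (auto simp: path_def)
  \<comment> \<open>The vertex \<open>a\<close> was visited by \<open>s\<close>, so a nonempty
    continuation cannot end there.\<close>
  have nil: "t = [] \<longleftrightarrow> a = u" if "walk G a t u" "distinct (v # heads s @ heads t)" for t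
    using walk_last[OF fin that(1)] that(2) a_mem last_in_set[of "heads t"] by (auto split: if_splits)
  show ?case
  proof (cases "a = u")
    case True
    thus ?thesis using nil[OF a(2) d1] nil[OF a2 d2] by simp
  next
    case False
    hence ne: "t1 \<noteq> []" "t2 \<noteq> []" using nil[OF a(2) d1] nil[OF a2 d2] by auto
    have "u \<in> set (heads t1)" "u \<in> set (heads t2)"
      using walk_last[OF fin a(2)] walk_last[OF fin a2] ne
        last_in_set[of "heads t1"] last_in_set[of "heads t2"] by auto
    hence "\<exists>x\<in>set t2. snd (snd x) \<in> set (heads t1)" by (force simp: mem_heads)
    then obtain x0 f c b y where t2: "t2 = x0 @ (f, c, b) # y" and b: "b \<in> set (heads t1)"
      and x0: "\<forall>x\<in>set x0. snd (snd x) \<notin> set (heads t1)"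
      by (auto dest!: split_list_first_prop)
    obtain f' c' z0 w where t1: "t1 = z0 @ (f', c', b) # w"
      using b by (auto simp: mem_heads dest!: split_list)
    define x z where "x = x0 @ [(f, c, b)]" and "z = z0 @ [(f', c', b)]"
    have t2': "t2 = x @ y" and t1': "t1 = z @ w" by (simp_all add: t1 t2 x_def z_def)
    have hx: "heads x = heads x0 @ [b]" and hz: "heads z = heads z0 @ [b]"
      by (simp_all add: x_def z_def)
    have x0': "set (heads x0) \<inter> set (heads t1) = {}" using x0 by (force simp: mem_heads)
    have walks: "walk G a x b" "walk G b y u" "walk G a z b" "walk G b w u"
    proof -
      obtain m where m: "walk G a x m" "walk G m y u" using a2 unfolding t2' walk_append[OF fin] by blast
      obtain n where n: "walk G a z n" "walk G n w u" using a(2) unfolding t1' walk_append[OF fin] by blast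
      have "m = b" "n = b" using walk_last[OF fin m(1)] walk_last[OF fin n(1)] by (simp_all add: hx hz)
      with m n show "walk G a x b" "walk G b y u" "walk G a z b" "walk G b w u" by auto
    qed
    have paths: "path G a z b" "path G a x b" "a \<noteq> b"
      using walks a_mem d1 d2 by (auto simp: path_def t1' t2' hx hz)
    have disj: "set (heads x) \<inter> set (heads z) \<subseteq> {b}" using x0' by (auto simp: hx hz t1')
    have swap: "path G v (s @ x @ w) u" using a(1) walks d1 d2 x0'
      by (auto simp: path_def walk_append[OF fin] t1' t2' hx hz)
    have "\<phi> (gain A \<gamma> ((e, u, v) # s @ z @ w)) \<otimes>\<^bsub>K\<^esub> inv\<^bsub>K\<^esub> gain K \<delta> (s @ z @ w)
       = \<phi> (gain A \<gamma> ((e, u, v) # s @ x @ w)) \<otimes>\<^bsub>K\<^esub> inv\<^bsub>K\<^esub> gain K \<delta> (s @ x @ w)"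
      using "1.prems" swap by (intro swap_step[OF \<delta> F e _ _ _ _ paths disj]) (auto simp: t1' t2')
    also have "\<dots> = \<phi> (gain A \<gamma> ((e, u, v) # (s @ x) @ y)) \<otimes>\<^bsub>K\<^esub> inv\<^bsub>K\<^esub> gain K \<delta> ((s @ x) @ y)"
    proof -
      have "length y < length t2" by (simp add: t2)
      moreover have "path G v ((s @ x) @ w) u" "path G v ((s @ x) @ y) u"
        "set (walk_edges ((s @ x) @ w)) \<subseteq> F" "set (walk_edges ((s @ x) @ y)) \<subseteq> F"
        using swap "1.prems" by (auto simp: t1' t2')
      ultimately show ?thesis using "1.IH" by (metis append.assoc)
    qed
    finally show ?thesis by (simp add: t1' t2')
  qed
qed

text \<open>The hypothesis on \<open>\<delta>\<close> concerns only cycles within \<open>F\<close>,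
  so its value on \<open>e\<close> may be overwritten.\<close>

lemma extend_gaining:
  assumes \<delta>: "gaining K G \<delta>"
    and F: "\<And>p. simple_closed G p \<Longrightarrow> set (walk_edges p) \<subseteq> F \<Longrightarrow> gain K \<delta> p = \<phi> (gain A \<gamma> p)"
    and e: "e \<in> edges G" "e \<notin> F"
  shows "\<exists>\<delta>'. gaining K G \<delta>' \<and>
    (\<forall>p. simple_closed G p \<and> set (walk_edges p) \<subseteq> insert e F \<longrightarrow> gain K \<delta>' p = \<phi> (gain A \<gamma> p))"
proof -
  obtain u v where arc: "(e, u, v) \<in> arcs G"
  proof -
    have "card (ends G e) = 1 \<or> card (ends G e) = 2" using fin e(1) by (auto simp: finite_graph_def)
    then obtain u v where "ends G e = {u, v}" by (auto simp: card_1_singleton_iff card_2_iff)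
    thus ?thesis using e(1) that mem_arcs_iff[OF fin] by blast
  qed
  define good where "good t \<longleftrightarrow> path G v t u \<and> set (walk_edges t) \<subseteq> F" for t
  \<comment> \<open>The only value at \<open>(e, u, v)\<close> that is correct on the cycle closed
    by \<open>t\<close>.\<close>
  define f where "f t = \<phi> (gain A \<gamma> ((e, u, v) # t)) \<otimes>\<^bsub>K\<^esub> inv\<^bsub>K\<^esub> gain K \<delta> t" for t
  have good_closed: "simple_closed G ((e, u, v) # t)" if "good t" for t
    using that arc e by (auto simp: good_def simple_closed_Cons[OF fin])
  have gK: "gain K \<delta> t \<in> carrier K" if "good t" for t
    using simple_closed_arcs[OF fin good_closed[OF that]] K.gaining_closed[OF \<delta>]
    by (intro K.gain_closed) auto
  have \<phi>K: "\<phi> (gain A \<gamma> ((e, u, v) # t)) \<in> carrier K" if "good t" for t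
    using \<phi>_closed D good_closed[OF that] by blast
  have "\<exists>k\<in>carrier K. \<forall>t. good t \<longrightarrow> k = f t"
  proof (cases "\<exists>t. good t")
    case True
    then obtain t0 where t0: "good t0" by blast
    have "f t0 = f t" if "good t" for t
      using potential_path_independent[OF \<delta> F arc e(2), of "[]" t0 t] t0 that
      by (simp add: f_def good_def)
    moreover have "f t0 \<in> carrier K" using gK \<phi>K t0 by (simp add: f_def)
    ultimately show ?thesis by blast
  \<comment> \<open>Without a return path in \<open>F\<close>, no cycle within
    \<open>insert e F\<close> uses \<open>e\<close>, and any value serves.\<close>
  qed (use K.one_closed in blast)
  then obtain k where k: "k \<in> carrier K" "\<And>t. good t \<Longrightarrow> k = f t" by blast
  \<comment> \<open>For a loop the two arcs coincide and the first clause applies.\<close>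
  define \<delta>' where "\<delta>' = (\<lambda>a. if a = (e, u, v) then k else if a = (e, v, u) then inv\<^bsub>K\<^esub> k else \<delta> a)"
  have \<delta>': "gaining K G \<delta>'"
    unfolding gaining_def
  proof (intro conjI allI impI funcsetI)
    fix a assume "a \<in> arcs G"
    thus "\<delta>' a \<in> carrier K" using K.gaining_closed[OF \<delta>] k(1) by (simp add: \<delta>'_def)
  next
    fix f x y assume f: "(f, x, y) \<in> arcs G \<and> \<not> is_loop G f"
    have "x \<noteq> y" using f is_loop_iff[OF fin, of f x y] by simp
    have \<delta>f: "\<delta> (f, y, x) = inv\<^bsub>K\<^esub> \<delta> (f, x, y)" using gaining_swap[OF \<delta>] f by blast
    consider "f = e" "x = u" "y = v" | "f = e" "x = v" "y = u"
      | "\<not> (f = e \<and> x = u \<and> y = v)" "\<not> (f = e \<and> x = v \<and> y = u)" by blast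
    thus "\<delta>' (f, y, x) = inv\<^bsub>K\<^esub> \<delta>' (f, x, y)"
    proof cases
      case 3
      hence "(f, x, y) \<notin> {(e, u, v), (e, v, u)}" "(f, y, x) \<notin> {(e, u, v), (e, v, u)}"
        unfolding insert_iff prod.inject by blast+
      hence "\<delta>' (f, x, y) = \<delta> (f, x, y)" "\<delta>' (f, y, x) = \<delta> (f, y, x)"
        unfolding \<delta>'_def insert_iff by meson+
      thus ?thesis using \<delta>f by (simp only:)
    qed (use \<open>x \<noteq> y\<close> k(1) in \<open>simp_all add: \<delta>'_def\<close>)
  qed
  have same: "gain K \<delta>' p = gain K \<delta> p" if "e \<notin> set (walk_edges p)" for p
  proof (rule gain_cong)
    fix a assume "a \<in> set p"
    hence "fst a \<noteq> e" using that by (auto simp: walk_edges_def)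
    hence "a \<noteq> (e, u, v)" "a \<noteq> (e, v, u)" by auto
    thus "\<delta>' a = \<delta> a" by (simp only: \<delta>'_def if_False)
  qed
  have main: "gain K \<delta>' p = \<phi> (gain A \<gamma> p)"
    if p: "simple_closed G p" "set (walk_edges p) \<subseteq> insert e F" and euv: "(e, u, v) \<in> set p" for p
  proof -
    obtain t where t: "simple_closed G ((e, u, v) # t)" "mset ((e, u, v) # t) = mset p"
      using simple_closed_rotate_to[OF fin p(1) euv] .
    have st: "set ((e, u, v) # t) = set p" using mset_eq_setD[OF t(2)] .
    have arcs: "set p \<subseteq> arcs G" using simple_closed_arcs[OF fin p(1)] .
    have et: "e \<notin> set (walk_edges t)" and "path G v t u"
      using t(1) by (auto simp: simple_closed_Cons[OF fin])
    moreover have "set (walk_edges t) \<subseteq> set (walk_edges p)"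
      unfolding walk_edges_def set_map using st by (intro image_mono) auto
    ultimately have good: "good t" using p(2) unfolding good_def by blast
    have "\<delta>' (e, u, v) = k" by (simp add: \<delta>'_def)
    hence "gain K \<delta>' ((e, u, v) # t) = f t \<otimes>\<^bsub>K\<^esub> gain K \<delta> t"
      using k(2)[OF good] same[of t] et by simp
    also have "\<dots> = \<phi> (gain A \<gamma> ((e, u, v) # t))"
      using gK[OF good] \<phi>K[OF good] by (simp add: f_def K.m_assoc del: gain_Cons)
    also have "gain A \<gamma> ((e, u, v) # t) = gain A \<gamma> p"
      using st arcs A.gaining_closed[OF \<gamma>] by (intro A.gain_mset_eq t(2)) auto
    also have "gain K \<delta>' ((e, u, v) # t) = gain K \<delta>' p"
      using st arcs K.gaining_closed[OF \<delta>'] by (intro K.gain_mset_eq t(2)) auto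
    finally show ?thesis .
  qed
  have "gain K \<delta>' p = \<phi> (gain A \<gamma> p)"
    if p: "simple_closed G p" "set (walk_edges p) \<subseteq> insert e F" for p
  proof (cases "e \<in> set (walk_edges p)")
    case False
    thus ?thesis using same F p by auto
  next
    case True
    then obtain x y where xy: "(e, x, y) \<in> set p" by (auto simp: mem_walk_edges)
    hence *: "(x, y) = (u, v) \<or> (x, y) = (v, u)"
      using arcs_same_edge[OF fin arc] simple_closed_arcs[OF fin p(1)] by blast
    show ?thesis
    proof (cases "(x, y) = (u, v)")
      case True
      thus ?thesis using main p xy by simp
    next
      case False
      with * have xy': "(e, v, u) \<in> set p" "u \<noteq> v" using xy by auto
      have arcs: "set p \<subseteq> arcs G" using simple_closed_arcs[OF fin p(1)] .
      \<comment> \<open>Here \<open>p\<close> runs through \<open>e\<close> from \<open>v\<close> to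
        \<open>u\<close>. The reversed walk is covered by \<open>main\<close>, and its gain is the
        inverse since \<open>p\<close> contains a non-loop and hence no loop.\<close>
      have loops: "\<forall>(g, c, d) \<in> set p. \<not> is_loop G g"
      proof (intro ballI, clarify)
        fix g c d assume g: "(g, c, d) \<in> set p" "is_loop G g"
        hence "c = d" using is_loop_iff[OF fin] arcs by blast
        thus False using simple_closed_loop[OF fin p(1), of g c] g xy' by auto
      qed
      have r: "simple_closed G (rev_walk p)" using simple_closed_rev_walk[OF fin p(1)] .
      have gA: "gain A \<gamma> p \<in> carrier A" "gain K \<delta>' p \<in> carrier K"
        using arcs A.gaining_closed[OF \<gamma>] K.gaining_closed[OF \<delta>']
        by (auto intro!: A.gain_closed K.gain_closed)
      have "(e, u, v) \<in> set (rev_walk p)" using xy' by (force simp: set_rev_walk)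
      hence "gain K \<delta>' (rev_walk p) = \<phi> (gain A \<gamma> (rev_walk p))" using main r p(2) by simp
      hence "inv\<^bsub>K\<^esub> gain K \<delta>' p = \<phi> (inv\<^bsub>A\<^esub> gain A \<gamma> p)"
        using A.gain_rev_walk[OF \<gamma> arcs loops] K.gain_rev_walk[OF \<delta>' arcs loops] by simp
      \<comment> \<open>The map \<open>\<phi>\<close> respects this inverse: the reversed walk puts
        it into \<open>D\<close>, and the product \<open>\<one>\<close> lies in \<open>D\<close>
        too.\<close>
      moreover have "\<one>\<^bsub>K\<^esub> = \<phi> (gain A \<gamma> p) \<otimes>\<^bsub>K\<^esub> \<phi> (inv\<^bsub>A\<^esub> gain A \<gamma> p)"
        using \<phi>_mult[of "gain A \<gamma> p" "inv\<^bsub>A\<^esub> gain A \<gamma> p"] D[OF p(1)] D[OF r] gA \<phi>_one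
          A.gain_rev_walk[OF \<gamma> arcs loops] by simp
      ultimately have "\<phi> (gain A \<gamma> p) \<otimes>\<^bsub>K\<^esub> inv\<^bsub>K\<^esub> gain K \<delta>' p = \<one>\<^bsub>K\<^esub>" by simp
      hence "inv\<^bsub>K\<^esub> (inv\<^bsub>K\<^esub> gain K \<delta>' p) = \<phi> (gain A \<gamma> p)"
        using gA \<phi>_closed[OF D[OF p(1)]] by (intro K.inv_equality) auto
      thus ?thesis using gA by simp
    qed
  qed
  thus ?thesis using \<delta>' by blast
qed

lemma lift_gaining:
  "\<exists>\<delta>. gaining K G \<delta> \<and> (\<forall>p. simple_closed G p \<longrightarrow> gain K \<delta> p = \<phi> (gain A \<gamma> p))"
proof -
  have "finite (edges G)" using fin by (simp add: finite_graph_def)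
  hence "\<exists>\<delta>. gaining K G \<delta> \<and>
     (\<forall>p. simple_closed G p \<and> set (walk_edges p) \<subseteq> edges G \<longrightarrow> gain K \<delta> p = \<phi> (gain A \<gamma> p))"
  proof (rule finite_subset_induct)
    \<comment> \<open>No simple closed walk has an empty edge set, so the induction may start from
      the trivial gaining.\<close>
    have "gaining K G (\<lambda>_. \<one>\<^bsub>K\<^esub>)" by (simp add: gaining_def)
    moreover have "\<not> (simple_closed G p \<and> set (walk_edges p) \<subseteq> {})" for p
      by (auto simp: simple_closed_def walk_edges_def)
    ultimately show "\<exists>\<delta>. gaining K G \<delta> \<and>
     (\<forall>p. simple_closed G p \<and> set (walk_edges p) \<subseteq> {} \<longrightarrow> gain K \<delta> p = \<phi> (gain A \<gamma> p))" by blast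
  qed (use extend_gaining in blast)+
  moreover have "set (walk_edges p) \<subseteq> edges G" if "simple_closed G p" for p
    using that unfolding simple_closed_def by (blast dest: walk_edges_subset)
  ultimately show ?thesis by blast
qed

end

end

section \<open>The groups of order three and four\<close>

lemma comm_group_DirProd:
  assumes "comm_group A" "comm_group B"
  shows "comm_group (A \<times>\<times> B)"
proof -
  interpret A: comm_group A by (rule assms)
  interpret B: comm_group B by (rule assms)
  show ?thesis
    by (rule group.group_comm_groupI[OF DirProd_group[OF A.group_axioms B.group_axioms]])
      (auto simp: A.m_comm B.m_comm)
qed

lemma gain_DirProd: "gain (A \<times>\<times> B) (\<lambda>a. (\<gamma> a, \<delta> a)) p = (gain A \<gamma> p, gain B \<delta> p)"
  by (induction p) auto

lemma gaining_DirProd: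
  assumes "group A" "group B" "gaining A G \<gamma>" "gaining B G \<delta>"
  shows "gaining (A \<times>\<times> B) G (\<lambda>a. (\<gamma> a, \<delta> a))"
  unfolding gaining_def
proof (intro conjI allI impI funcsetI)
  fix a assume "a \<in> arcs G"
  thus "(\<gamma> a, \<delta> a) \<in> carrier (A \<times>\<times> B)"
    using group.gaining_closed[OF assms(1,3)] group.gaining_closed[OF assms(2,4)] by simp
next
  fix e u v assume e: "(e, u, v) \<in> arcs G \<and> \<not> is_loop G e"
  hence "\<gamma> (e, u, v) \<in> carrier A" "\<delta> (e, u, v) \<in> carrier B"
    using group.gaining_closed[OF assms(1,3)] group.gaining_closed[OF assms(2,4)] by blast+
  moreover have "\<gamma> (e, v, u) = inv\<^bsub>A\<^esub> \<gamma> (e, u, v)" "\<delta> (e, v, u) = inv\<^bsub>B\<^esub> \<delta> (e, u, v)"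
    using gaining_swap[OF assms(3)] gaining_swap[OF assms(4)] e by blast+
  ultimately show "(\<gamma> (e, v, u), \<delta> (e, v, u)) = inv\<^bsub>A \<times>\<times> B\<^esub> (\<gamma> (e, u, v), \<delta> (e, u, v))"
    using inv_DirProd[OF assms(1,2)] by simp
qed

text \<open>
  The nonzero elements of \<open>\<int>\<^sub>2\<times>\<int>\<^sub>2\<close> get the weights \<open>1\<close>, \<open>1\<close>, \<open>-2\<close> and the element \<open>s\<close> of \<open>\<int>\<^sub>3\<close> acts as a sign.
  Of three compatible nonzero elements with \<open>a + b = c\<close>, the signs of \<open>a\<close> and \<open>b\<close> agree and the sign
  of \<open>c\<close> is opposite, while all three weights occur; hence additivity amounts to \<open>1 + 1 - 2 = 0\<close>.
\<close>

definition integer_lift :: "int \<times> int \<times> int \<Rightarrow> int" where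
  "integer_lift = (\<lambda>(s, y, z). (if s = 2 then - 1 else s) * (y + z - 4 * y * z))"

definition compatible :: "(int \<times> int \<times> int) set" where
  "compatible = {(s, y, z). s \<in> {0, 1, 2} \<and> y \<in> {0, 1} \<and> z \<in> {0, 1} \<and> (s = 0 \<longleftrightarrow> (y, z) = (0, 0))}"

lemma compatible_eq:
  "compatible = {(0,0,0), (1,0,1), (1,1,0), (1,1,1), (2,0,1), (2,1,0), (2,1,1)}"
  by (auto simp: compatible_def)

abbreviation (input) Z3 :: "int monoid" where "Z3 \<equiv> integer_mod_group 3"

abbreviation (input) V4 :: "(int \<times> int) monoid" where "V4 \<equiv> integer_mod_group 2 \<times>\<times> integer_mod_group 2"

lemma carrier_Z3: "carrier Z3 = {0, 1, 2}" and carrier_V4: "carrier V4 = {(0, 0), (0, 1), (1, 0), (1, 1)}"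
  by (auto simp: carrier_integer_mod_group)

lemma comm_groups: "comm_group Z3" "comm_group V4" "comm_group (Z3 \<times>\<times> V4)"
  by (simp_all add: comm_group_DirProd)

lemma integer_lift_mult:
  assumes "x \<in> compatible" "y \<in> compatible" "x \<otimes>\<^bsub>Z3 \<times>\<times> V4\<^esub> y \<in> compatible"
  shows "integer_lift (x \<otimes>\<^bsub>Z3 \<times>\<times> V4\<^esub> y) = integer_lift x + integer_lift y"
proof -
  have "\<forall>x\<in>compatible. \<forall>y\<in>compatible. x \<otimes>\<^bsub>Z3 \<times>\<times> V4\<^esub> y \<in> compatible \<longrightarrow>
      integer_lift (x \<otimes>\<^bsub>Z3 \<times>\<times> V4\<^esub> y) = integer_lift x + integer_lift y"
    by (simp add: compatible_eq integer_lift_def)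
  thus ?thesis using assms by blast
qed

text \<open>The bound 2 is what leaves only an element and its square to be checked in the target
  group.\<close>

lemma integer_lift_values:
  assumes "x \<in> compatible"
  shows "integer_lift x \<in> {-2, -1, 0, 1, 2}" and "integer_lift x = 0 \<longleftrightarrow> x = (0, 0, 0)"
  using assms unfolding compatible_eq integer_lift_def by auto

text \<open>The pair of gainings over \<open>Z3\<close> and \<open>V4\<close> is lifted along
  \<open>integer_lift\<close>, with \<open>compatible\<close> as the set of admissible
  gains.\<close>

lemma integer_gaining:
  assumes fin: "finite_graph G" and "gainable Z3 G \<B>" and "gainable V4 G \<B>"
  obtains \<delta> where "gaining integer_group G \<delta>" and "\<B> = balanced_cycles integer_group G \<delta>"
    and "\<And>p. simple_closed G p \<Longrightarrow> gain integer_group \<delta> p \<in> {-2, -1, 0, 1, 2}"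
proof -
  obtain \<beta> where \<beta>: "gaining Z3 G \<beta>" "\<B> = balanced_cycles Z3 G \<beta>"
    using assms by (auto simp: gainable_def)
  obtain \<eta> where \<eta>: "gaining V4 G \<eta>" "\<B> = balanced_cycles V4 G \<eta>"
    using assms by (auto simp: gainable_def)
  define \<gamma> where "\<gamma> = (\<lambda>a. (\<beta> a, \<eta> a))"
  interpret Z3: comm_group Z3 by (rule comm_groups)
  interpret V4: comm_group V4 by (rule comm_groups)
  have \<gamma>: "gaining (Z3 \<times>\<times> V4) G \<gamma>"
    unfolding \<gamma>_def by (intro gaining_DirProd Z3.group_axioms V4.group_axioms \<beta>(1) \<eta>(1))
  have gain: "gain (Z3 \<times>\<times> V4) \<gamma> p = (gain Z3 \<beta> p, gain V4 \<eta> p)" for p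
    by (simp only: \<gamma>_def gain_DirProd)
  \<comment> \<open>Both gainings define the same \<open>\<B>\<close>, so their gains on a cycle
    vanish together.\<close>
  have iff: "gain Z3 \<beta> p = 0 \<longleftrightarrow> gain V4 \<eta> p = (0, 0)" if p: "simple_closed G p" for p
    using Z3.walk_graph_balanced_iff[OF fin \<beta>(1) p] V4.walk_graph_balanced_iff[OF fin \<eta>(1) p]
    by (simp add: \<beta>(2)[symmetric] \<eta>(2)[symmetric])
  have compat: "gain (Z3 \<times>\<times> V4) \<gamma> p \<in> compatible" if p: "simple_closed G p" for p
  proof -
    have "gain Z3 \<beta> p \<in> carrier Z3" "gain V4 \<eta> p \<in> carrier V4"
      using simple_closed_arcs[OF fin p] Z3.gaining_closed[OF \<beta>(1)] V4.gaining_closed[OF \<eta>(1)]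
      by (blast intro: Z3.gain_closed V4.gain_closed)+
    with iff[OF p] show ?thesis
      unfolding gain compatible_def carrier_Z3 carrier_V4 by (cases "gain V4 \<eta> p") auto
  qed
  obtain \<delta> where \<delta>: "gaining integer_group G \<delta>"
    "\<And>p. simple_closed G p \<Longrightarrow> gain integer_group \<delta> p = integer_lift (gain (Z3 \<times>\<times> V4) \<gamma> p)"
    using lift_gaining[OF fin comm_groups(3) abelian_integer_group \<gamma>, of compatible integer_lift]
      compat integer_lift_mult by (auto simp: compatible_def integer_lift_def)
  have "balanced_cycles Z3 G \<beta> = balanced_cycles integer_group G \<delta>"
  proof (rule balanced_cycles_eqI[OF fin])
    fix p assume p: "simple_closed G p"
    show "gain Z3 \<beta> p = \<one>\<^bsub>Z3\<^esub> \<longleftrightarrow> gain integer_group \<delta> p = \<one>\<^bsub>integer_group\<^esub>"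
      using integer_lift_values(2)[OF compat[OF p]] \<delta>(2)[OF p] iff[OF p] gain[of p] by simp
  qed
  with \<beta>(2) \<delta> show ?thesis
    using integer_lift_values(1)[OF compat] by (intro that[of \<delta>]) auto
qed

text \<open>The integer gains are mapped to powers of \<open>g\<close>. Neither \<open>g\<close> nor
  \<open>g \<otimes> g\<close> is trivial, so the only trivial power with exponent between -2 and 2
  is the zeroth.\<close>

lemma (in group) gainable_of_non_involution:
  assumes "finite_graph H" "gainable Z3 H \<B>" "gainable V4 H \<B>"
    and g: "g \<in> carrier G" "g \<otimes> g \<noteq> \<one>"
  shows "gainable G H \<B>"
proof -
  obtain \<delta> where \<delta>: "gaining integer_group H \<delta>" "\<B> = balanced_cycles integer_group H \<delta>"
    and val: "\<And>p. simple_closed H p \<Longrightarrow> gain integer_group \<delta> p \<in> {-2, -1, 0, 1, 2}"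
    using integer_gaining[OF assms(1-3)] by blast
  have "g \<noteq> \<one>" using g by auto
  have sq: "g [^] (2::int) = g \<otimes> g" using int_pow_mult[OF g(1), of 1 1] g(1) by simp
  have neg: "g [^] (- k) \<noteq> \<one>" if "g [^] k \<noteq> \<one>" for k :: int
    using that g(1) by (simp only: int_pow_neg inv_eq_1_iff int_pow_closed not_False_eq_True)
  have "g [^] (1::int) \<noteq> \<one>" "g [^] (2::int) \<noteq> \<one>"
    using g \<open>g \<noteq> \<one>\<close> sq by simp_all
  hence pow: "g [^] k \<noteq> \<one>" if "k \<in> {-2, -1, 1, 2}" for k :: int
    using that neg[of 1] neg[of 2] by (elim insertE emptyE) (simp_all only: simp_thms)
  have one: "gain integer_group \<delta> p = \<one>\<^bsub>integer_group\<^esub>"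
    if p: "simple_closed H p" "g [^] gain integer_group \<delta> p = \<one>" for p
    using val[OF p(1)] pow[of "gain integer_group \<delta> p"] p(2) unfolding one_integer_group by blast
  from gainable_hom[OF assms(1) group_integer_group is_group hom_integer_group_pow[OF g(1)] \<delta>(1) one]
  show ?thesis by (simp only: \<delta>(2))
qed

text \<open>In exponent two, \<open>g\<close> and \<open>k\<close> generate a copy of
  \<open>V4\<close>, into which the \<open>V4\<close>-gaining is carried.\<close>

lemma (in group) gainable_of_involutions:
  assumes "finite_graph H" "gainable V4 H \<B>"
    and sq: "\<And>x. x \<in> carrier G \<Longrightarrow> x \<otimes> x = \<one>"
    and g: "g \<in> carrier G" "k \<in> carrier G" "g \<noteq> \<one>" "k \<noteq> \<one>" "g \<noteq> k"
  shows "gainable G H \<B>"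
proof -
  \<comment> \<open>The embedding sends \<open>(1, 0)\<close> to \<open>g\<close> and
    \<open>(0, 1)\<close> to \<open>k\<close>.\<close>
  define h where "h = (\<lambda>(y, z). (if y = (0::int) then \<one> else g) \<otimes> (if z = (0::int) then \<one> else k))"
  have inv: "inv x = x" if "x \<in> carrier G" for x
    using sq[OF that] that by (simp add: inv_equality)
  \<comment> \<open>Every element is its own inverse, so inverting a product merely swaps its
    factors.\<close>
  have comm: "x \<otimes> y = y \<otimes> x" if "x \<in> carrier G" "y \<in> carrier G" for x y
  proof -
    have "x \<otimes> y = inv (x \<otimes> y)" using inv[of "x \<otimes> y"] that by simp
    also have "\<dots> = inv y \<otimes> inv x" using that by (rule inv_mult_group)
    finally have "x \<otimes> y = inv y \<otimes> inv x" .
    also have "\<dots> = y \<otimes> x" using that by (simp add: inv)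
    finally show ?thesis .
  qed
  have ne: "g \<otimes> k \<noteq> \<one>" using g inv inv_equality[of g k] by auto
  have mult: "g \<otimes> g = \<one>" "k \<otimes> k = \<one>" "k \<otimes> g = g \<otimes> k" "g \<otimes> k \<otimes> (g \<otimes> k) = \<one>"
    using sq comm g(1,2) by simp_all
  have mult3: "g \<otimes> (g \<otimes> k) = k" "g \<otimes> k \<otimes> k = g"
    using mult g(1,2) m_assoc[of g g k] m_assoc[of g k k] by simp_all
  hence "g \<otimes> k \<otimes> g = k" "k \<otimes> (g \<otimes> k) = g"
    using comm[of "g \<otimes> k" g] comm[of k "g \<otimes> k"] g(1,2) by simp_all
  note mult = mult mult3 this
  have h: "h (0, 0) = \<one>" "h (0, 1) = k" "h (1, 0) = g" "h (1, 1) = g \<otimes> k"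
    using g by (simp_all add: h_def)
  have hom: "h \<in> hom V4 G"
  proof (rule homI)
    fix x y assume "x \<in> carrier V4" "y \<in> carrier V4"
    thus "h (x \<otimes>\<^bsub>V4\<^esub> y) = h x \<otimes> h y"
      unfolding carrier_V4 by (elim insertE emptyE) (simp_all add: h mult g)
  qed (use g in \<open>unfold carrier_V4, auto simp: h\<close>)
  have ker: "x = (0, 0)" if "x \<in> carrier V4" "h x = \<one>" for x
    using that g ne unfolding carrier_V4 by (elim insertE emptyE) (simp_all add: h)
  obtain \<eta> where \<eta>: "gaining V4 H \<eta>" "\<B> = balanced_cycles V4 H \<eta>"
    using assms(2) unfolding gainable_def by blast
  interpret V4: comm_group V4 by (rule comm_groups)
  have "gain V4 \<eta> p = \<one>\<^bsub>V4\<^esub>" if p: "simple_closed H p" "h (gain V4 \<eta> p) = \<one>" for p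
  proof -
    have "gain V4 \<eta> p \<in> carrier V4"
      using simple_closed_arcs[OF assms(1) p(1)] V4.gaining_closed[OF \<eta>(1)]
      by (blast intro: V4.gain_closed)
    from ker[OF this p(2)] show ?thesis by simp
  qed
  from gainable_hom[OF assms(1) V4.group_axioms group_axioms hom \<eta>(1) this]
  show ?thesis by (simp only: \<eta>(2))
qed

lemma (in group) gainable_at_least_three:
  assumes "finite_graph H" "gainable Z3 H \<B>" "gainable V4 H \<B>" "at_least_three G"
  shows "gainable G H \<B>"
proof (cases "\<exists>g\<in>carrier G. g \<otimes> g \<noteq> \<one>")
  case True
  thus ?thesis using gainable_of_non_involution assms by blast
next
  case False
  \<comment> \<open>Removing the identity leaves at least two elements, which supply
    \<open>g\<close> and \<open>k\<close>.\<close>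
  have "infinite (carrier G - {\<one>}) \<or> 2 \<le> card (carrier G - {\<one>})"
    using assms(4) by (auto simp: at_least_three_def order_def card_Diff_singleton_if)
  then obtain S where "S \<subseteq> carrier G - {\<one>}" "card S = 2"
  proof (elim disjE)
    assume "infinite (carrier G - {\<one>})"
    thus ?thesis using that infinite_arbitrarily_large by blast
  next
    assume "2 \<le> card (carrier G - {\<one>})"
    thus ?thesis using that obtain_subset_with_card_n by metis
  qed
  then obtain g k where "g \<in> carrier G" "k \<in> carrier G" "g \<noteq> \<one>" "k \<noteq> \<one>" "g \<noteq> k"
    by (auto simp: card_2_iff)
  thus ?thesis using gainable_of_involutions assms False by blast
qed

text \<open>The assumption \<open>all\<close> speaks only of groups on the type \<open>'g\<close>.
  An infinite type has room for an isomorphic copy of any finite group, and a gaining over the copy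
  is pulled back.\<close>

lemma (in group) gainable_of_copies:
  fixes H :: "('v, 'e) multigraph" and \<B> :: "('v, 'e) subgraph set"
  assumes "finite_graph H" "infinite (UNIV :: 'g set)" "finite (carrier G)" "3 \<le> order G"
    and all: "\<And>\<Gamma> :: 'g monoid. group \<Gamma> \<Longrightarrow> at_least_three \<Gamma> \<Longrightarrow> gainable \<Gamma> H \<B>"
  shows "gainable G H \<B>"
proof -
  obtain S :: "'g set" where "finite S" "card S = card (carrier G)"
    using infinite_arbitrarily_large[OF assms(2)] by blast
  then obtain f where "bij_betw f (carrier G) S"
    using finite_same_card_bij[OF assms(3)] by metis
  hence inj: "inj_on f (carrier G)" by (simp add: bij_betw_def)
  define \<Gamma> where "\<Gamma> = image_group f G"
  have grp: "group \<Gamma>" unfolding \<Gamma>_def using inj_imp_image_group_is_group[OF inj] .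
  have iso: "f \<in> iso G \<Gamma>" unfolding \<Gamma>_def using inj_imp_image_group_iso[OF inj] .
  have "order \<Gamma> = order G" by (simp add: \<Gamma>_def order_def image_group_carrier card_image inj)
  then obtain \<gamma> where \<gamma>: "gaining \<Gamma> H \<gamma>" "\<B> = balanced_cycles \<Gamma> H \<gamma>"
    using all[OF grp] assms(4) by (auto simp: at_least_three_def gainable_def)
  \<comment> \<open>The inverse isomorphism, leading from the copy back to the original
    group.\<close>
  define h where "h = inv_into (carrier G) f"
  have h: "h \<in> iso \<Gamma> G" unfolding h_def using iso_set_sym[OF iso] .
  have h_hom: "h \<in> hom \<Gamma> G" and h_inj: "inj_on h (carrier \<Gamma>)"
    using h by (simp_all add: iso_def bij_betw_def)
  have "gain \<Gamma> \<gamma> p = \<one>\<^bsub>\<Gamma>\<^esub>" if p: "simple_closed H p" "h (gain \<Gamma> \<gamma> p) = \<one>" for p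
  proof -
    have "gain \<Gamma> \<gamma> p \<in> carrier \<Gamma>"
      using simple_closed_arcs[OF assms(1) p(1)] group.gaining_closed[OF grp \<gamma>(1)]
      by (blast intro: group.gain_closed[OF grp])
    moreover have "h (gain \<Gamma> \<gamma> p) = h \<one>\<^bsub>\<Gamma>\<^esub>"
      using p(2) hom_one[OF h_hom grp is_group] by simp
    ultimately show ?thesis
      using inj_onD[OF h_inj] monoid.one_closed[OF group.is_monoid[OF grp]] by blast
  qed
  from gainable_hom[OF assms(1) grp is_group h_hom \<gamma>(1) this]
  show ?thesis by (simp only: \<gamma>(2))
qed

text \<open>The quantifier over groups ranges over those carried by the fixed type
  \<open>'g\<close>; its infinitude makes room for copies of \<open>Z3\<close> and
  \<open>V4\<close>.\<close>

theorem theorem1p6: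
  fixes G :: "('v, 'e) multigraph" and \<B> :: "('v, 'e) subgraph set"
  assumes "biased_graph G \<B>"
    and "infinite (UNIV :: 'g set)"
  shows "(\<forall>\<Gamma> :: 'g monoid. group \<Gamma> \<and> at_least_three \<Gamma> \<longrightarrow> gainable \<Gamma> G \<B>) \<longleftrightarrow>
    gainable (integer_mod_group 3) G \<B> \<and>
    gainable (integer_mod_group 2 \<times>\<times> integer_mod_group 2) G \<B>"
proof
  have fin: "finite_graph G" using assms(1) by (simp add: biased_graph_def)
  {
    assume "\<forall>\<Gamma> :: 'g monoid. group \<Gamma> \<and> at_least_three \<Gamma> \<longrightarrow> gainable \<Gamma> G \<B>"
    hence all: "\<And>\<Gamma> :: 'g monoid. group \<Gamma> \<Longrightarrow> at_least_three \<Gamma> \<Longrightarrow> gainable \<Gamma> G \<B>"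
      by blast
    \<comment> \<open>Both groups have order at least three but live on other types than
      \<open>'g\<close>, so copies are used.\<close>
    have "finite (carrier Z3)" "3 \<le> order Z3" "finite (carrier V4)" "3 \<le> order V4"
      unfolding order_def carrier_Z3 carrier_V4 by simp_all
    thus "gainable Z3 G \<B> \<and> gainable V4 G \<B>"
      using group.gainable_of_copies[OF comm_group.axioms(2)[OF comm_groups(1)] fin assms(2) _ _ all]
        group.gainable_of_copies[OF comm_group.axioms(2)[OF comm_groups(2)] fin assms(2) _ _ all]
      by (intro conjI)
  next
    assume "gainable Z3 G \<B> \<and> gainable V4 G \<B>"
    thus "\<forall>\<Gamma> :: 'g monoid. group \<Gamma> \<and> at_least_three \<Gamma> \<longrightarrow> gainable \<Gamma> G \<B>"
      using group.gainable_at_least_three[OF _ fin] by blast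
  }
qed

end
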